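(* Let $(x(t),z(t),\xi(t),\theta(t))$ be a solution of the Hamiltonian system of the quaternion $\mathbb H$-type group with the Lorentzian metric with $x(0)=0$, $z(0)=0$ and $\dot x_i(0)=\dot x_i^0$, $i=1,\dots,4$. Then $\theta_1,\theta_2,\theta_3$ are constants. Put $a=\sqrt{\theta_1^2+\theta_2^2+\theta_3^2}$, $$c_1=\frac{a\dot x_1^0-\theta_1\dot x_2^0+\theta_3\dot x_3^0+\theta_2\dot x_4^0}{2a^2},\qquad c_2=\frac{a\dot x_1^0+\theta_1\dot x_2^0-\theta_3\dot x_3^0-\theta_2\dot x_4^0}{2a^2},$$ $$c_3=\frac{\theta_1\theta_3\dot x_2^0+(\theta_1^2+\theta_2^2)\dot x_3^0-\theta_2\theta_3\dot x_4^0}{2a^2(\theta_1^2+\theta_2^2)},\qquad c_4=-\frac{\theta_2\dot x_2^0+\theta_1\dot x_4^0}{2a(\theta_1^2+\theta_2^2)},$$ and $k=(c_3^2+c_4^2)(\theta_1^2+\theta_2^2)$. Then the geodesic $(x(t),z(t))$ is given by $$x_1=A_1\sinh(at)+B_1\cosh(at)+E_1,$$ $$x_j=A_j\sinh(at)+B_j\cosh(at)+C_j\sin(at)+D_j\cos(at)+E_j,\quad j=2,3,4,$$ and, for $i=1,2,3$, $$z_i=a\alpha^i_0t+\beta^i_1\sinh(at)\sin(at)+\beta^i_2\cosh(at)\cos(at)+\beta^i_3\sinh(at)\cos(at)+\beta^i_4\cosh(at)\sin(at)$$ $$\qquad+\alpha^i_5\sinh(at)+\alpha^i_6\cosh(at)+\alpha^i_7\sin(at)+\alpha^i_8\cos(at)-\beta^i_2.$$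 The coefficients of the $x_i$ are $$A_1=c_1+c_2,\quad A_2=\tfrac{\theta_1(c_2-c_1)}{a},\quad A_3=\tfrac{\theta_3(c_1-c_2)}{a},\quad A_4=\tfrac{\theta_2(c_1-c_2)}{a},$$ $$B_1=c_1-c_2,\quad B_2=-\tfrac{\theta_1(c_1+c_2)}{a},\quad B_3=\tfrac{\theta_3(c_1+c_2)}{a},\quad B_4=\tfrac{\theta_2(c_1+c_2)}{a},$$ $$C_2=\tfrac{2(c_3\theta_1\theta_3-c_4a\theta_2)}{a},\quad C_3=\tfrac{2c_3(\theta_1^2+\theta_2^2)}{a},\quad C_4=-\tfrac{2(c_4a\theta_1+c_3\theta_2\theta_3)}{a},$$ $$D_2=\tfrac{2(c_4\theta_1\theta_3+c_3a\theta_2)}{a},\quad D_3=\tfrac{2c_4(\theta_1^2+\theta_2^2)}{a},\quad D_4=\tfrac{2(c_3a\theta_1-c_4\theta_2\theta_3)}{a},$$ $$E_1=c_2-c_1,\quad E_2=\tfrac{\theta_1(c_1+c_2)}{a}-\tfrac{2(c_4\theta_1\theta_3+c_3a\theta_2)}{a},$$ $$E_3=-\tfrac{\theta_3(c_1+c_2)}{a}-\tfrac{2c_4(\theta_1^2+\theta_2^2)}{a},\quad E_4=-\tfrac{\theta_2(c_1+c_2)}{a}-\tfrac{2(c_3a\theta_1-c_4\theta_2\theta_3)}{a}.$$ The coefficients of the $z_i$ are, for $i=1,2,3$, $$\beta^i_1=\tfrac14(\alpha^i_1+\alpha^i_4),\quad \beta^i_2=\tfrac14(-\alpha^i_1+\alpha^i_4),\quad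 \beta^i_3=\tfrac14(-\alpha^i_2+\alpha^i_3),\quad \beta^i_4=\tfrac14(\alpha^i_2+\alpha^i_3),$$ $$\alpha^i_0=\tfrac{2\theta_i}{a}(-c_1c_2+k),$$ $$\alpha^1_1=\tfrac4a(c_1+c_2)(c_3\theta_1\theta_3-ac_4\theta_2),\ \ \alpha^2_1=\tfrac4a(c_1+c_2)(c_3\theta_2\theta_3+ac_4\theta_1),\ \ \alpha^3_1=-\tfrac{4c_3}{a}(c_1+c_2)(\theta_1^2+\theta_2^2),$$ $$\alpha^1_2=\tfrac4a(c_1-c_2)(c_3\theta_1\theta_3-ac_4\theta_2),\ \ \alpha^2_2=\tfrac4a(c_1-c_2)(c_3\theta_2\theta_3+ac_4\theta_1),\ \ \alpha^3_2=-\tfrac{4c_3}{a}(c_1-c_2)(\theta_1^2+\theta_2^2),$$ $$\alpha^1_3=\tfrac4a(c_1+c_2)(c_4\theta_1\theta_3+ac_3\theta_2),\ \ \alpha^2_3=\tfrac4a(c_1+c_2)(c_4\theta_2\theta_3-ac_3\theta_1),\ \ \alpha^3_3=-\tfrac{4c_4}{a}(c_1+c_2)(\theta_1^2+\theta_2^2),$$ $$\alpha^1_4=\tfrac4a(c_1-c_2)(c_4\theta_1\theta_3+ac_3\theta_2),\ \ \alpha^2_4=\tfrac4a(c_1-c_2)(c_4\theta_2\theta_3-ac_3\theta_1),\ \ \alpha^3_4=-\tfrac{4c_4}{a}(c_1-c_2)(\theta_1^2+\theta_2^2),$$ $$\alpha^1_5=-2\theta_2(c_3(c_1+c_2)-c_4(c_1-c_2))+\tfrac{4c_1c_2\theta_1}{a}-\tfrac{2\theta_1\theta_3}{a}(c_3(c_1-c_2)+c_4(c_1+c_2)),$$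 $$\alpha^2_5=2\theta_1(c_3(c_1+c_2)-c_4(c_1-c_2))+\tfrac{4c_1c_2\theta_2}{a}-\tfrac{2\theta_2\theta_3}{a}(c_3(c_1-c_2)+c_4(c_1+c_2)),$$ $$\alpha^3_5=\tfrac2a(\theta_1^2+\theta_2^2)(c_3(c_1-c_2)+c_4(c_1+c_2))+\tfrac{4c_1c_2\theta_3}{a},$$ $$\alpha^1_6=2\theta_2(-c_3(c_1-c_2)+c_4(c_1+c_2))-\tfrac{2\theta_1\theta_3}{a}(c_3(c_1+c_2)+c_4(c_1-c_2)),$$ $$\alpha^2_6=2\theta_1(c_3(c_1-c_2)-c_4(c_1+c_2))-\tfrac{2\theta_2\theta_3}{a}(c_3(c_1+c_2)+c_4(c_1-c_2)),$$ $$\alpha^3_6=\tfrac2a(\theta_1^2+\theta_2^2)(c_3(c_1+c_2)+c_4(c_1-c_2)),$$ $$\alpha^1_7=-2\theta_2(c_3(c_1+c_2)+c_4(c_1-c_2))-\tfrac{2\theta_1\theta_3}{a}(-c_3(c_1-c_2)+c_4(c_1+c_2))-\tfrac4a\theta_1k,$$ $$\alpha^2_7=2\theta_1(c_3(c_1+c_2)+c_4(c_1-c_2))-\tfrac{2\theta_2\theta_3}{a}(-c_3(c_1-c_2)+c_4(c_1+c_2))-\tfrac4a\theta_2k,$$ $$\alpha^3_7=-\tfrac2a(\theta_1^2+\theta_2^2)(c_3(c_1-c_2)-c_4(c_1+c_2))-\tfrac4a\theta_3k,$$ $$\alpha^i_8=-\alpha^i_6.$$ Moreover, $$-x_1^2+x_2^2+x_3^2+x_4^2=-16c_1c_2\sinh^2\!\big(\tfrac{at}{2}\big)+16k\sin^2\!\big(\tfrac{at}{2}\big)$$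 and $$z_1^2+z_2^2+z_3^2=4\big(at(-c_1c_2+k)+2c_1c_2\sinh(at)-2k\sin(at)\big)^2$$ $$\qquad-4k(c_1^2e^{at}+c_2^2e^{-at})\big(4\sin(at)\sinh(at)+5\cos(at)-5\cosh(at)\big)$$ $$\qquad+8c_1c_2k\big(5\sin(at)\sinh(at)+4\cos(at)-4\cosh(at)\big),$$ where $-c_1c_2+k=\frac{1}{4a^2}\|v_0\|^2$ with $\|v_0\|^2=-(\dot x_1^0)^2+(\dot x_2^0)^2+(\dot x_3^0)^2+(\dot x_4^0)^2$.
   Context: The quaternion $\mathbb H$-type group is $\mathbb R^4\times\mathbb R^3$ with coordinates $(x,z)=(x_1,\dots,x_4,z_1,z_2,z_3)$; its horizontal bundle has the frame $$X_1=\partial_{x_1}+\tfrac12(x_2\partial_{z_1}-x_4\partial_{z_2}-x_3\partial_{z_3}),\quad X_2=\partial_{x_2}+\tfrac12(-x_1\partial_{z_1}-x_3\partial_{z_2}+x_4\partial_{z_3}),$$ $$X_3=\partial_{x_3}+\tfrac12(x_4\partial_{z_1}+x_2\partial_{z_2}+x_1\partial_{z_3}),\quad X_4=\partial_{x_4}+\tfrac12(-x_3\partial_{z_1}+x_1\partial_{z_2}-x_2\partial_{z_3}),$$ with the Lorentzian metric $Q$ given by $Q(X_1,X_1)=-1$, $Q(X_j,X_j)=1$ for $j=2,3,4$, and $Q(X_i,X_j)=0$ for $i\neq j$. The associated Hamiltonian on phase space, with momenta $\xi=(\xi_1,\dots,\xi_4)$ dual to $x$ and $\theta=(\theta_1,\theta_2,\theta_3)$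 dual to $z$, is $H=\frac12(-p_1^2+p_2^2+p_3^2+p_4^2)$, where $p_i$ is the symbol of $X_i$: $$p_1=\xi_1+\tfrac12(x_2\theta_1-x_4\theta_2-x_3\theta_3),\quad p_2=\xi_2+\tfrac12(-x_1\theta_1-x_3\theta_2+x_4\theta_3),$$ $$p_3=\xi_3+\tfrac12(x_4\theta_1+x_2\theta_2+x_1\theta_3),\quad p_4=\xi_4+\tfrac12(-x_3\theta_1+x_1\theta_2-x_2\theta_3).$$ The Hamiltonian system is $\dot x_i=\partial H/\partial\xi_i$, $\dot z_j=\partial H/\partial\theta_j$, $\dot\xi_i=-\partial H/\partial x_i$, $\dot\theta_j=-\partial H/\partial z_j$. A geodesic is the projection of a solution to $(x,z)$-space. The $z$-coordinates are obtained by integrating the horizontality conditions $$\dot z_1=\tfrac12(x_2\dot x_1-x_1\dot x_2+x_4\dot x_3-x_3\dot x_4),\quad \dot z_2=\tfrac12(-x_4\dot x_1-x_3\dot x_2+x_2\dot x_3+x_1\dot x_4),$$ $$\dot z_3=\tfrac12(-x_3\dot x_1+x_4\dot x_2+x_1\dot x_3-x_2\dot x_4).$$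
   Formalization: In z_i the terms with α_5,…,α_8 carry a factor 1/2; in |z|^2, 2c_1c_2 sinh−2k sin becomes c_1c_2 sinh−k sin, and (4,5,−5), (5,4,−4) become (2,2,−2). As printed both fail for θ=(1,0,0), x'(0)=(1,0,0,0). θ_1^2+θ_2^2≠0 is assumed so that c_3, c_4 are defined. *)

theory Defs
  imports "HOL-Analysis.Analysis"
begin

text \<open>
  Points of the group are pairs \<open>(x, z)\<close> with \<open>x :: real^4\<close>, \<open>z :: real^3\<close>. A tangent vector is given
  by its components with respect to \<open>\<partial>\<^bsub>x\<^sub>1\<^esub>, \<dots>, \<partial>\<^bsub>x\<^sub>4\<^esub>, \<partial>\<^bsub>z\<^sub>1\<^esub>, \<partial>\<^bsub>z\<^sub>2\<^esub>, \<partial>\<^bsub>z\<^sub>3\<^esub>\<close>. In the index type \<open>4\<close> the numeral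
  \<open>4\<close> is the fourth index (it equals \<open>0\<close> there), likewise \<open>3\<close> in the index type \<open>3\<close>.
\<close>

definition frame :: "4 \<Rightarrow> real^4 \<Rightarrow> real^3 \<Rightarrow> (real^4) \<times> (real^3)" where
  "frame i x z = (axis i 1, (1/2) *\<^sub>R
     (if i = 1 then vector [x$2, - x$4, - x$3]
      else if i = 2 then vector [- x$1, - x$3, x$4]
      else if i = 3 then vector [x$4, x$2, x$1]
      else vector [- x$3, x$1, - x$2]))"

text \<open>The symbol of the \<open>i\<close>-th frame field at the covector \<open>(\<xi>, \<theta>)\<close>.\<close>

definition symbol :: "4 \<Rightarrow> real^4 \<Rightarrow> real^3 \<Rightarrow> real^4 \<Rightarrow> real^3 \<Rightarrow> real" where
  "symbol i x z \<xi> \<theta> = (\<xi>, \<theta>) \<bullet> frame i x z"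

lemma symbol_simps:
  "symbol 1 x z \<xi> \<theta> = \<xi>$1 + 1/2 * (x$2 * \<theta>$1 - x$4 * \<theta>$2 - x$3 * \<theta>$3)"
  "symbol 2 x z \<xi> \<theta> = \<xi>$2 + 1/2 * (- x$1 * \<theta>$1 - x$3 * \<theta>$2 + x$4 * \<theta>$3)"
  "symbol 3 x z \<xi> \<theta> = \<xi>$3 + 1/2 * (x$4 * \<theta>$1 + x$2 * \<theta>$2 + x$1 * \<theta>$3)"
  "symbol 4 x z \<xi> \<theta> = \<xi>$4 + 1/2 * (- x$3 * \<theta>$1 + x$1 * \<theta>$2 - x$2 * \<theta>$3)"
  by (simp_all add: symbol_def frame_def inner_axis inner_vec_def[of \<theta>] sum_3 algebra_simps)

definition hamiltonian :: "real^4 \<Rightarrow> real^3 \<Rightarrow> real^4 \<Rightarrow> real^3 \<Rightarrow> real" where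
  "hamiltonian x z \<xi> \<theta> = 1/2 * (- (symbol 1 x z \<xi> \<theta>)\<^sup>2 + (symbol 2 x z \<xi> \<theta>)\<^sup>2
                                + (symbol 3 x z \<xi> \<theta>)\<^sup>2 + (symbol 4 x z \<xi> \<theta>)\<^sup>2)"

definition partial_deriv :: "'n::finite \<Rightarrow> (real^'n \<Rightarrow> real) \<Rightarrow> real^'n \<Rightarrow> real" where
  "partial_deriv i F p = deriv (\<lambda>s. F (p + s *\<^sub>R axis i 1)) 0"

definition hamiltonian_solution ::
  "real set \<Rightarrow> (real \<Rightarrow> real^4) \<Rightarrow> (real \<Rightarrow> real^3) \<Rightarrow> (real \<Rightarrow> real^4) \<Rightarrow> (real \<Rightarrow> real^3) \<Rightarrow> bool" where
  "hamiltonian_solution T x z \<xi> \<theta> \<longleftrightarrow> (\<forall>t\<in>T.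
     (\<forall>i. ((\<lambda>s. x s $ i) has_real_derivative
            partial_deriv i (\<lambda>\<eta>. hamiltonian (x t) (z t) \<eta> (\<theta> t)) (\<xi> t)) (at t within T)) \<and>
     (\<forall>j. ((\<lambda>s. z s $ j) has_real_derivative
            partial_deriv j (\<lambda>\<eta>. hamiltonian (x t) (z t) (\<xi> t) \<eta>) (\<theta> t)) (at t within T)) \<and>
     (\<forall>i. ((\<lambda>s. \<xi> s $ i) has_real_derivative
            - partial_deriv i (\<lambda>y. hamiltonian y (z t) (\<xi> t) (\<theta> t)) (x t)) (at t within T)) \<and>
     (\<forall>j. ((\<lambda>s. \<theta> s $ j) has_real_derivative
            - partial_deriv j (\<lambda>w. hamiltonian (x t) w (\<xi> t) (\<theta> t)) (z t)) (at t within T)))"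

text \<open>\<open>\<parallel>v\<parallel>\<^sup>2\<close> for the Lorentzian metric, in frame coordinates; it may be negative.\<close>

definition lorentz_sq :: "real^4 \<Rightarrow> real" where
  "lorentz_sq v = - (v$1)\<^sup>2 + (v$2)\<^sup>2 + (v$3)\<^sup>2 + (v$4)\<^sup>2"

text \<open>
  Parameters and coefficients of the geodesics, as functions of the (constant) momentum \<open>\<theta>\<close> and the
  initial velocity \<open>v\<close>. They are meaningful for \<open>\<theta>\<^sub>1\<^sup>2 + \<theta>\<^sub>2\<^sup>2 \<noteq> 0\<close> only.
\<close>

definition par_a :: "real^3 \<Rightarrow> real" where
  "par_a \<theta> = sqrt ((\<theta>$1)\<^sup>2 + (\<theta>$2)\<^sup>2 + (\<theta>$3)\<^sup>2)"

definition par_c1 :: "real^3 \<Rightarrow> real^4 \<Rightarrow> real" where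
  "par_c1 \<theta> v = (let a = par_a \<theta> in
     (a * v$1 - \<theta>$1 * v$2 + \<theta>$3 * v$3 + \<theta>$2 * v$4) / (2 * a\<^sup>2))"

definition par_c2 :: "real^3 \<Rightarrow> real^4 \<Rightarrow> real" where
  "par_c2 \<theta> v = (let a = par_a \<theta> in
     (a * v$1 + \<theta>$1 * v$2 - \<theta>$3 * v$3 - \<theta>$2 * v$4) / (2 * a\<^sup>2))"

definition par_c3 :: "real^3 \<Rightarrow> real^4 \<Rightarrow> real" where
  "par_c3 \<theta> v = (let a = par_a \<theta> in
     (\<theta>$1 * \<theta>$3 * v$2 + ((\<theta>$1)\<^sup>2 + (\<theta>$2)\<^sup>2) * v$3 - \<theta>$2 * \<theta>$3 * v$4)
       / (2 * a\<^sup>2 * ((\<theta>$1)\<^sup>2 + (\<theta>$2)\<^sup>2)))"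

definition par_c4 :: "real^3 \<Rightarrow> real^4 \<Rightarrow> real" where
  "par_c4 \<theta> v = (let a = par_a \<theta> in
     - ((\<theta>$2 * v$2 + \<theta>$1 * v$4) / (2 * a * ((\<theta>$1)\<^sup>2 + (\<theta>$2)\<^sup>2))))"

definition par_k :: "real^3 \<Rightarrow> real^4 \<Rightarrow> real" where
  "par_k \<theta> v = ((par_c3 \<theta> v)\<^sup>2 + (par_c4 \<theta> v)\<^sup>2) * ((\<theta>$1)\<^sup>2 + (\<theta>$2)\<^sup>2)"

definition coeff_A :: "real^3 \<Rightarrow> real^4 \<Rightarrow> real^4" where
  "coeff_A \<theta> v = (let a = par_a \<theta>; c1 = par_c1 \<theta> v; c2 = par_c2 \<theta> v in
     vector [c1 + c2, \<theta>$1 * (c2 - c1) / a, \<theta>$3 * (c1 - c2) / a, \<theta>$2 * (c1 - c2) / a])"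

definition coeff_B :: "real^3 \<Rightarrow> real^4 \<Rightarrow> real^4" where
  "coeff_B \<theta> v = (let a = par_a \<theta>; c1 = par_c1 \<theta> v; c2 = par_c2 \<theta> v in
     vector [c1 - c2, - (\<theta>$1 * (c1 + c2) / a), \<theta>$3 * (c1 + c2) / a, \<theta>$2 * (c1 + c2) / a])"

text \<open>The trigonometric terms occur for \<open>j = 2, 3, 4\<close> only; the first entries of \<open>C\<close> and \<open>D\<close> are unused.\<close>

definition coeff_C :: "real^3 \<Rightarrow> real^4 \<Rightarrow> real^4" where
  "coeff_C \<theta> v = (let a = par_a \<theta>; c3 = par_c3 \<theta> v; c4 = par_c4 \<theta> v in
     vector [0,
       2 * (c3 * \<theta>$1 * \<theta>$3 - c4 * a * \<theta>$2) / a,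
       2 * c3 * ((\<theta>$1)\<^sup>2 + (\<theta>$2)\<^sup>2) / a,
       - (2 * (c4 * a * \<theta>$1 + c3 * \<theta>$2 * \<theta>$3) / a)])"

definition coeff_D :: "real^3 \<Rightarrow> real^4 \<Rightarrow> real^4" where
  "coeff_D \<theta> v = (let a = par_a \<theta>; c3 = par_c3 \<theta> v; c4 = par_c4 \<theta> v in
     vector [0,
       2 * (c4 * \<theta>$1 * \<theta>$3 + c3 * a * \<theta>$2) / a,
       2 * c4 * ((\<theta>$1)\<^sup>2 + (\<theta>$2)\<^sup>2) / a,
       2 * (c3 * a * \<theta>$1 - c4 * \<theta>$2 * \<theta>$3) / a])"

definition coeff_E :: "real^3 \<Rightarrow> real^4 \<Rightarrow> real^4" where
  "coeff_E \<theta> v = (let a = par_a \<theta>; c1 = par_c1 \<theta> v; c2 = par_c2 \<theta> v;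
                       c3 = par_c3 \<theta> v; c4 = par_c4 \<theta> v in
     vector [c2 - c1,
       \<theta>$1 * (c1 + c2) / a - 2 * (c4 * \<theta>$1 * \<theta>$3 + c3 * a * \<theta>$2) / a,
       - (\<theta>$3 * (c1 + c2) / a) - 2 * c4 * ((\<theta>$1)\<^sup>2 + (\<theta>$2)\<^sup>2) / a,
       - (\<theta>$2 * (c1 + c2) / a) - 2 * (c3 * a * \<theta>$1 - c4 * \<theta>$2 * \<theta>$3) / a])"

definition alpha0 :: "real^3 \<Rightarrow> real^4 \<Rightarrow> real^3" where
  "alpha0 \<theta> v = (\<chi> i. 2 * \<theta>$i / par_a \<theta> * (- par_c1 \<theta> v * par_c2 \<theta> v + par_k \<theta> v))"

definition alpha1 :: "real^3 \<Rightarrow> real^4 \<Rightarrow> real^3" where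
  "alpha1 \<theta> v = (let a = par_a \<theta>; c1 = par_c1 \<theta> v; c2 = par_c2 \<theta> v;
                     c3 = par_c3 \<theta> v; c4 = par_c4 \<theta> v in
     vector [4 / a * (c1 + c2) * (c3 * \<theta>$1 * \<theta>$3 - a * c4 * \<theta>$2),
             4 / a * (c1 + c2) * (c3 * \<theta>$2 * \<theta>$3 + a * c4 * \<theta>$1),
             - (4 * c3 / a * (c1 + c2) * ((\<theta>$1)\<^sup>2 + (\<theta>$2)\<^sup>2))])"

definition alpha2 :: "real^3 \<Rightarrow> real^4 \<Rightarrow> real^3" where
  "alpha2 \<theta> v = (let a = par_a \<theta>; c1 = par_c1 \<theta> v; c2 = par_c2 \<theta> v;
                     c3 = par_c3 \<theta> v; c4 = par_c4 \<theta> v in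
     vector [4 / a * (c1 - c2) * (c3 * \<theta>$1 * \<theta>$3 - a * c4 * \<theta>$2),
             4 / a * (c1 - c2) * (c3 * \<theta>$2 * \<theta>$3 + a * c4 * \<theta>$1),
             - (4 * c3 / a * (c1 - c2) * ((\<theta>$1)\<^sup>2 + (\<theta>$2)\<^sup>2))])"

definition alpha3 :: "real^3 \<Rightarrow> real^4 \<Rightarrow> real^3" where
  "alpha3 \<theta> v = (let a = par_a \<theta>; c1 = par_c1 \<theta> v; c2 = par_c2 \<theta> v;
                     c3 = par_c3 \<theta> v; c4 = par_c4 \<theta> v in
     vector [4 / a * (c1 + c2) * (c4 * \<theta>$1 * \<theta>$3 + a * c3 * \<theta>$2),
             4 / a * (c1 + c2) * (c4 * \<theta>$2 * \<theta>$3 - a * c3 * \<theta>$1),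
             - (4 * c4 / a * (c1 + c2) * ((\<theta>$1)\<^sup>2 + (\<theta>$2)\<^sup>2))])"

definition alpha4 :: "real^3 \<Rightarrow> real^4 \<Rightarrow> real^3" where
  "alpha4 \<theta> v = (let a = par_a \<theta>; c1 = par_c1 \<theta> v; c2 = par_c2 \<theta> v;
                     c3 = par_c3 \<theta> v; c4 = par_c4 \<theta> v in
     vector [4 / a * (c1 - c2) * (c4 * \<theta>$1 * \<theta>$3 + a * c3 * \<theta>$2),
             4 / a * (c1 - c2) * (c4 * \<theta>$2 * \<theta>$3 - a * c3 * \<theta>$1),
             - (4 * c4 / a * (c1 - c2) * ((\<theta>$1)\<^sup>2 + (\<theta>$2)\<^sup>2))])"

definition alpha5 :: "real^3 \<Rightarrow> real^4 \<Rightarrow> real^3" where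
  "alpha5 \<theta> v = (let a = par_a \<theta>; c1 = par_c1 \<theta> v; c2 = par_c2 \<theta> v;
                     c3 = par_c3 \<theta> v; c4 = par_c4 \<theta> v in
     vector [- 2 * \<theta>$2 * (c3 * (c1 + c2) - c4 * (c1 - c2)) + 4 * c1 * c2 * \<theta>$1 / a
               - 2 * \<theta>$1 * \<theta>$3 / a * (c3 * (c1 - c2) + c4 * (c1 + c2)),
             2 * \<theta>$1 * (c3 * (c1 + c2) - c4 * (c1 - c2)) + 4 * c1 * c2 * \<theta>$2 / a
               - 2 * \<theta>$2 * \<theta>$3 / a * (c3 * (c1 - c2) + c4 * (c1 + c2)),
             2 / a * ((\<theta>$1)\<^sup>2 + (\<theta>$2)\<^sup>2) * (c3 * (c1 - c2) + c4 * (c1 + c2))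
               + 4 * c1 * c2 * \<theta>$3 / a])"

definition alpha6 :: "real^3 \<Rightarrow> real^4 \<Rightarrow> real^3" where
  "alpha6 \<theta> v = (let a = par_a \<theta>; c1 = par_c1 \<theta> v; c2 = par_c2 \<theta> v;
                     c3 = par_c3 \<theta> v; c4 = par_c4 \<theta> v in
     vector [2 * \<theta>$2 * (- c3 * (c1 - c2) + c4 * (c1 + c2))
               - 2 * \<theta>$1 * \<theta>$3 / a * (c3 * (c1 + c2) + c4 * (c1 - c2)),
             2 * \<theta>$1 * (c3 * (c1 - c2) - c4 * (c1 + c2))
               - 2 * \<theta>$2 * \<theta>$3 / a * (c3 * (c1 + c2) + c4 * (c1 - c2)),
             2 / a * ((\<theta>$1)\<^sup>2 + (\<theta>$2)\<^sup>2) * (c3 * (c1 + c2) + c4 * (c1 - c2))])"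

definition alpha7 :: "real^3 \<Rightarrow> real^4 \<Rightarrow> real^3" where
  "alpha7 \<theta> v = (let a = par_a \<theta>; c1 = par_c1 \<theta> v; c2 = par_c2 \<theta> v;
                     c3 = par_c3 \<theta> v; c4 = par_c4 \<theta> v; k = par_k \<theta> v in
     vector [- 2 * \<theta>$2 * (c3 * (c1 + c2) + c4 * (c1 - c2))
               - 2 * \<theta>$1 * \<theta>$3 / a * (- c3 * (c1 - c2) + c4 * (c1 + c2)) - 4 / a * \<theta>$1 * k,
             2 * \<theta>$1 * (c3 * (c1 + c2) + c4 * (c1 - c2))
               - 2 * \<theta>$2 * \<theta>$3 / a * (- c3 * (c1 - c2) + c4 * (c1 + c2)) - 4 / a * \<theta>$2 * k,
             - 2 / a * ((\<theta>$1)\<^sup>2 + (\<theta>$2)\<^sup>2) * (c3 * (c1 - c2) - c4 * (c1 + c2))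
               - 4 / a * \<theta>$3 * k])"

definition alpha8 :: "real^3 \<Rightarrow> real^4 \<Rightarrow> real^3" where
  "alpha8 \<theta> v = - alpha6 \<theta> v"

text \<open>
  Pitfall: with these \<open>\<alpha>\<^sub>5, \<dots>, \<alpha>\<^sub>8\<close> the corresponding terms must enter \<open>z\<close> with the factor \<open>1/2\<close> of
  the horizontality conditions. (The \<open>\<beta>\<close> below and \<open>\<alpha>\<^sub>0\<close> already contain it.) Without it the velocity
  \<open>z'(0)\<close> would be nonzero, while horizontality and \<open>x(0) = 0\<close> force \<open>z'(0) = 0\<close>: for
  \<open>\<theta> = (1,0,0)\<close>, \<open>v = (1,0,0,0)\<close> the geodesic has \<open>z\<^sub>1 = (sinh t - t) / 2\<close>, and
  \<open>a \<alpha>\<^sub>0 = -1/2\<close>, \<open>\<alpha>\<^sub>5 = 1\<close>, the first components of the other \<open>\<alpha>\<close> being \<open>0\<close>.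
\<close>

definition beta1 :: "real^3 \<Rightarrow> real^4 \<Rightarrow> real^3" where
  "beta1 \<theta> v = (1/4) *\<^sub>R (alpha1 \<theta> v + alpha4 \<theta> v)"

definition beta2 :: "real^3 \<Rightarrow> real^4 \<Rightarrow> real^3" where
  "beta2 \<theta> v = (1/4) *\<^sub>R (- alpha1 \<theta> v + alpha4 \<theta> v)"

definition beta3 :: "real^3 \<Rightarrow> real^4 \<Rightarrow> real^3" where
  "beta3 \<theta> v = (1/4) *\<^sub>R (- alpha2 \<theta> v + alpha3 \<theta> v)"

definition beta4 :: "real^3 \<Rightarrow> real^4 \<Rightarrow> real^3" where
  "beta4 \<theta> v = (1/4) *\<^sub>R (alpha2 \<theta> v + alpha3 \<theta> v)"

end

theory Submission
  imports Defs
begin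

text \<open>
  Since \<open>\<theta>\<close> is conserved, the Hamiltonian system integrates once to \<open>x' = M x + v\<close>, where \<open>M\<close> depends
  linearly on \<open>\<theta>\<close>. Write \<open>s = x\<^sub>1\<close> and \<open>Y = (- x\<^sub>2, x\<^sub>4, x\<^sub>3)\<close>. The system becomes
  \<open>s' = \<theta> \<bullet> Y + v\<^sub>1\<close>, \<open>Y' = s \<theta> + \<theta> \<times> Y + V\<close>, and horizontality reads \<open>z' = (s Y' - s' Y + Y \<times> Y') / 2\<close>.
  In the orthogonal frame \<open>n = \<theta> / a\<close>, \<open>F\<close>, \<open>G = n \<times> F\<close>, with \<open>a F\<close> the part of \<open>V\<close> orthogonal to \<open>\<theta>\<close>,
  the pair (\<open>s\<close>, \<open>n\<close>-component) moves hyperbolically and the orthogonal part of \<open>Y\<close> moves on a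
  circle. A Gronwall estimate gives uniqueness, \<open>z\<close> is found by integration along the frame, and all
  coefficients \<open>\<alpha>\<^sub>i\<close> are combinations of \<open>n\<close>, \<open>F\<close>, \<open>G\<close>; as \<open>F \<bullet> F = G \<bullet> G = 4 k\<close>, this gives the two
  quadratic identities too.
\<close>

section \<open>Partial derivatives of the Hamiltonian\<close>

lemma symbol_affine:
  "symbol i x z (\<xi> + s *\<^sub>R \<eta>) \<theta> = symbol i x z \<xi> \<theta> + s * symbol i 0 0 \<eta> 0"
  "symbol i x z \<xi> (\<theta> + s *\<^sub>R \<zeta>) = symbol i x z \<xi> \<theta> + s * symbol i x 0 0 \<zeta>"
  "symbol i (x + s *\<^sub>R y) z \<xi> \<theta> = symbol i x z \<xi> \<theta> + s * symbol i y 0 0 \<theta>"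
  using exhaust_4[of i] by (auto simp: symbol_simps algebra_simps)

text \<open>By \<open>symbol_affine\<close>, the Hamiltonian restricted to a coordinate line is a
  Lorentzian square of affine functions; its derivative is the polarized form of the values
  \<open>p\<close> and the slopes \<open>q\<close>.\<close>

lemma deriv_lorentz_form_affine:
  fixes p q :: "4 \<Rightarrow> real"
  shows "deriv (\<lambda>s. 1/2 * (- (p 1 + s * q 1)\<^sup>2 + (p 2 + s * q 2)\<^sup>2 + (p 3 + s * q 3)\<^sup>2 + (p 4 + s * q 4)\<^sup>2)) 0
    = - p 1 * q 1 + p 2 * q 2 + p 3 * q 3 + p 4 * q 4"
  by (rule DERIV_imp_deriv) (auto intro!: derivative_eq_intros simp: algebra_simps)

lemma partial_deriv_hamiltonian:
  fixes x \<xi> :: "real^4" and z \<theta> :: "real^3"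
  defines "p \<equiv> \<lambda>i. symbol i x z \<xi> \<theta>"
  shows "partial_deriv i (\<lambda>\<eta>. hamiltonian x z \<eta> \<theta>) \<xi> = (let q = \<lambda>j. symbol j 0 0 (axis i 1) 0
      in - p 1 * q 1 + p 2 * q 2 + p 3 * q 3 + p 4 * q 4)"
    and "partial_deriv l (\<lambda>\<zeta>. hamiltonian x z \<xi> \<zeta>) \<theta> = (let q = \<lambda>j. symbol j x 0 0 (axis l 1)
      in - p 1 * q 1 + p 2 * q 2 + p 3 * q 3 + p 4 * q 4)"
    and "partial_deriv i (\<lambda>y. hamiltonian y z \<xi> \<theta>) x = (let q = \<lambda>j. symbol j (axis i 1) 0 0 \<theta>
      in - p 1 * q 1 + p 2 * q 2 + p 3 * q 3 + p 4 * q 4)"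
  unfolding partial_deriv_def hamiltonian_def symbol_affine p_def Let_def
  by (rule deriv_lorentz_form_affine)+

lemma partial_deriv_position_z: "partial_deriv j (\<lambda>w. hamiltonian x w \<xi> \<theta>) z = 0"
  unfolding partial_deriv_def hamiltonian_def symbol_simps by simp

section \<open>Uniqueness for linear differential equations on an interval\<close>

lemma linear_ode_zero_forward:
  fixes w :: "real \<Rightarrow> real^'n"
  assumes "bounded_linear M" and "0 \<le> t"
    and deriv: "\<And>s i. s \<in> {0..t} \<Longrightarrow>
      ((\<lambda>s. w s $ i) has_real_derivative M (w s) $ i) (at s within {0..t})"
    and "w 0 = 0"
  shows "w t = 0"
proof -
  obtain K where K: "\<And>y. norm (M y) \<le> norm y * K"
    using bounded_linear.bounded[OF \<open>bounded_linear M\<close>] by blast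
  \<comment> \<open>Gronwall weight: as \<open>K\<close> bounds \<open>M\<close>, Cauchy-Schwarz
    gives \<open>w \<bullet> M w \<le> K * (w \<bullet> w)\<close>, so the factor
    \<open>exp (- 2 * K * s)\<close> makes \<open>g\<close> nonincreasing. Since \<open>g\<close>
    starts at 0, it cannot become positive.\<close>
  define g where "g s = exp (- 2 * K * s) * (w s \<bullet> w s)" for s
  define g' where "g' s = exp (- 2 * K * s) * (2 * (w s \<bullet> M (w s)) - 2 * K * (w s \<bullet> w s))" for s
  have g: "(g has_real_derivative g' s) (at s within {0..t})" if "s \<in> {0..t}" for s
  proof -
    have "((\<lambda>s. w s \<bullet> w s) has_real_derivative 2 * (w s \<bullet> M (w s))) (at s within {0..t})"
      unfolding inner_vec_def inner_real_def sum_distrib_left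
      by (rule DERIV_sum) (auto intro!: derivative_eq_intros deriv that)
    then show ?thesis
      unfolding g_def g'_def by (auto intro!: derivative_eq_intros simp: algebra_simps)
  qed
  have g'_le: "g' s \<le> 0" for s
  proof -
    have "w s \<bullet> M (w s) \<le> norm (w s) * norm (M (w s))"
      by (rule norm_cauchy_schwarz)
    also have "\<dots> \<le> norm (w s) * (norm (w s) * K)"
      by (intro mult_left_mono K) simp
    also have "\<dots> = K * (w s \<bullet> w s)"
      by (simp add: dot_square_norm power2_eq_square)
    finally show ?thesis
      unfolding g'_def by (simp add: mult_nonneg_nonpos)
  qed
  have "g t \<le> g 0"
  proof (rule DERIV_nonpos_imp_decreasing_open[OF \<open>0 \<le> t\<close>])
    show "continuous_on {0..t} g"
      using g by (meson DERIV_continuous continuous_on_eq_continuous_within)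
    show "\<exists>y. (g has_real_derivative y) (at s) \<and> y \<le> 0" if "0 < s" "s < t" for s
      using g[of s] g'_le[of s] that at_within_Icc_at[of 0 s t] by auto
  qed
  then have "w t \<bullet> w t \<le> 0"
    by (simp add: g_def \<open>w 0 = 0\<close> mult_le_0_iff)
  then show ?thesis
    by (simp add: inner_gt_zero_iff flip: not_less)
qed

text \<open>For negative times the reversed curve solves the equation with \<open>- M\<close>, so
  the forward case applies to it. Only the segment between 0 and \<open>t\<close> enters, hence
  \<open>T\<close> may be any interval around or starting at 0.\<close>

lemma linear_ode_zero:
  fixes w :: "real \<Rightarrow> real^'n"
  assumes "is_interval T" "0 \<in> T" "t \<in> T" and M: "bounded_linear M"
    and deriv: "\<And>s i. s \<in> T \<Longrightarrow>
      ((\<lambda>s. w s $ i) has_real_derivative M (w s) $ i) (at s within T)"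
    and "w 0 = 0"
  shows "w t = 0"
proof (cases "0 \<le> t")
  case True
  then have sub: "{0..t} \<subseteq> T"
    using assms(1-3) mem_is_interval_1_I[of T 0 t] by auto
  show ?thesis
    by (rule linear_ode_zero_forward[OF M True])
      (use sub deriv DERIV_subset \<open>w 0 = 0\<close> in blast)+
next
  case False
  then have sub: "uminus ` {0..-t} \<subseteq> T"
    using assms(1-3) mem_is_interval_1_I[of T t 0] by auto
  have "((\<lambda>s. w (- s) $ i) has_real_derivative - M (w (- s)) $ i) (at s within {0..-t})"
    if "s \<in> {0..-t}" for s i
  proof -
    have "((\<lambda>s. w s $ i) has_real_derivative M (w (- s)) $ i) (at (- s) within uminus ` {0..-t})"
      using deriv[of "- s" i] sub that DERIV_subset by blast
    moreover have "(uminus has_real_derivative -1) (at s within {0..-t})"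
      by (auto intro!: derivative_eq_intros)
    ultimately show ?thesis
      using DERIV_image_chain[of "\<lambda>s. w s $ i" _ uminus s "{0..-t}" "-1"] by (simp add: o_def)
  qed
  note deriv_minus = this
  have "w (- (- t)) = 0"
  proof (rule linear_ode_zero_forward[where w = "\<lambda>s. w (- s)" and t = "- t"])
    show "bounded_linear (\<lambda>y. - M y)"
      using M by (rule bounded_linear_minus)
  qed (use deriv_minus False \<open>w 0 = 0\<close> in auto)
  then show ?thesis by simp
qed

section \<open>From the Hamiltonian system to a linear equation for the position\<close>

lemma vector_4 [simp]:
  fixes a b c d :: "'a::zero"
  shows "(vector [a, b, c, d] :: 'a^4) $ 1 = a" "(vector [a, b, c, d] :: 'a^4) $ 2 = b"
    "(vector [a, b, c, d] :: 'a^4) $ 3 = c" "(vector [a, b, c, d] :: 'a^4) $ 4 = d"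
  unfolding vector_def by simp_all

lemma interval_zero_derivative_const:
  fixes f :: "real \<Rightarrow> real"
  assumes "is_interval T" "0 \<in> T" "t \<in> T"
    and "\<And>s. s \<in> T \<Longrightarrow> (f has_real_derivative 0) (at s within T)"
  shows "f t = f 0"
  using has_field_derivative_zero_constant[OF is_interval_convex[OF assms(1)] assms(4)] assms(2,3)
  by metis

text \<open>
  The linear part of the geodesic equation \<open>x' = rotation \<theta> x + v\<close>: the symbols evolve by \<open>p' = \<Omega> x'\<close>
  with \<open>\<Omega>\<close> skew, and \<open>x' = (- p\<^sub>1, p\<^sub>2, p\<^sub>3, p\<^sub>4)\<close>, so \<open>rotation\<close> is \<open>\<Omega>\<close> with its first row negated.
\<close>

definition rotation :: "real^3 \<Rightarrow> real^4 \<Rightarrow> real^4" where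
  "rotation \<omega> y = vector
     [- \<omega>$1 * y$2 + \<omega>$3 * y$3 + \<omega>$2 * y$4, - \<omega>$1 * y$1 - \<omega>$2 * y$3 + \<omega>$3 * y$4,
      \<omega>$3 * y$1 + \<omega>$2 * y$2 + \<omega>$1 * y$4, \<omega>$2 * y$1 - \<omega>$3 * y$2 - \<omega>$1 * y$3]"

text \<open>The right-hand sides of the three horizontality conditions.\<close>

definition vertical_velocity :: "real^4 \<Rightarrow> real^4 \<Rightarrow> real^3" where
  "vertical_velocity y u = (1/2) *\<^sub>R vector
     [y$2 * u$1 - y$1 * u$2 + y$4 * u$3 - y$3 * u$4,
      - y$4 * u$1 - y$3 * u$2 + y$2 * u$3 + y$1 * u$4,
      - y$3 * u$1 + y$4 * u$2 + y$1 * u$3 - y$2 * u$4]"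

lemma bounded_linear_rotation: "bounded_linear (rotation \<omega>)"
  unfolding linear_conv_bounded_linear[symmetric]
  by (rule linearI) (simp_all add: rotation_def vec_eq_iff forall_4 algebra_simps)

lemma has_derivative_rotation:
  assumes "\<And>i. ((\<lambda>s. y s $ i) has_real_derivative (y' :: real^4) $ i) (at t within T)"
  shows "((\<lambda>s. rotation \<omega> (y s) $ i) has_real_derivative rotation \<omega> y' $ i) (at t within T)"
proof -
  consider "i = 1" | "i = 2" | "i = 3" | "i = 4" using exhaust_4[of i] by blast
  then show ?thesis
    by cases (simp_all only: rotation_def vector_4, (intro derivative_intros assms DERIV_cmult)+)
qed

text \<open>A derivative within \<open>T\<close> at 0 determines the initial velocity only if 0 is a
  limit point of \<open>T\<close>. A connected set with more than one point has no isolated points,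
  so the only exception is \<open>{0}\<close>, where every derivative claim is vacuous.\<close>

lemma is_interval_at_within_0_cases:
  fixes T :: "real set"
  assumes "is_interval T" "0 \<in> T"
  obtains "T = {0}" "at 0 within T = bot" | "at 0 within T \<noteq> bot"
proof (cases "T = {0}")
  case False
  have "connected T"
    using assms(1) by (simp add: is_interval_connected_1)
  then have "0 islimpt T"
    using connected_imp_perfect[of T 0] assms(2) False by auto
  then show ?thesis
    using that(2) trivial_limit_within by blast
qed (use that(1) in \<open>simp add: at_within_eq_bot_iff\<close>)

context
  fixes T :: "real set" and x \<xi> :: "real \<Rightarrow> real^4" and z \<theta> :: "real \<Rightarrow> real^3"
  assumes T: "is_interval T" "0 \<in> T"
    and sol: "hamiltonian_solution T x z \<xi> \<theta>"
begin

lemma hamiltonian_solution_momentum_const: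
  assumes "t \<in> T"
  shows "\<theta> t = \<theta> 0"
proof -
  have "((\<lambda>s. \<theta> s $ j) has_real_derivative 0) (at s within T)" if "s \<in> T" for s j
    using sol that unfolding hamiltonian_solution_def partial_deriv_position_z by simp
  from interval_zero_derivative_const[OF T assms this] show ?thesis
    by (simp add: vec_eq_iff)
qed

lemma hamiltonian_solution_ode:
  fixes v :: "real^4"
  assumes "x 0 = 0" and v: "\<And>i. ((\<lambda>t. x t $ i) has_real_derivative v $ i) (at 0 within T)"
    and "t \<in> T"
  defines "u \<equiv> rotation (\<theta> 0) (x t) + v"
  shows "((\<lambda>s. x s $ i) has_real_derivative u $ i) (at t within T)"
    and "((\<lambda>s. z s $ j) has_real_derivative vertical_velocity (x t) u $ j) (at t within T)"
proof -
  define \<omega> where "\<omega> = \<theta> 0"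
  define p where "p i s = symbol i (x s) (z s) (\<xi> s) \<omega>" for i s
  \<comment> \<open>The velocity of \<open>x\<close>: the metric flips the sign of the first
    symbol.\<close>
  define q where "q s = (vector [- p 1 s, p 2 s, p 3 s, p 4 s] :: real^4)" for s
  have \<theta>: "\<theta> s = \<omega>" if "s \<in> T" for s
    using hamiltonian_solution_momentum_const[OF that] by (simp add: \<omega>_def)
  have dx: "((\<lambda>s. x s $ i) has_real_derivative q s $ i) (at s within T)" if "s \<in> T" for s i
  proof -
    have "((\<lambda>s. x s $ i) has_real_derivative
        partial_deriv i (\<lambda>\<eta>. hamiltonian (x s) (z s) \<eta> \<omega>) (\<xi> s)) (at s within T)"
      using sol that \<theta>[OF that] unfolding hamiltonian_solution_def by auto
    moreover have "partial_deriv i (\<lambda>\<eta>. hamiltonian (x s) (z s) \<eta> \<omega>) (\<xi> s) = q s $ i"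
      using exhaust_4[of i]
      by (auto simp: partial_deriv_hamiltonian q_def p_def Let_def symbol_simps(1-4)[of 0 0] axis_def)
    ultimately show ?thesis by simp
  qed
  have dz: "((\<lambda>s. z s $ j) has_real_derivative vertical_velocity (x s) (q s) $ j) (at s within T)"
    if "s \<in> T" for s j
  proof -
    have "((\<lambda>s. z s $ j) has_real_derivative
        partial_deriv j (\<lambda>\<eta>. hamiltonian (x s) (z s) (\<xi> s) \<eta>) \<omega>) (at s within T)"
      using sol that \<theta>[OF that] unfolding hamiltonian_solution_def by auto
    moreover have "partial_deriv j (\<lambda>\<eta>. hamiltonian (x s) (z s) (\<xi> s) \<eta>) \<omega>
        = vertical_velocity (x s) (q s) $ j"
      using exhaust_3[of j]
      by (auto simp: partial_deriv_hamiltonian q_def p_def Let_def symbol_simps(1-4)[of _ 0 0] axis_def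
          vertical_velocity_def algebra_simps)
    ultimately show ?thesis by simp
  qed
  have d\<xi>: "((\<lambda>s. \<xi> s $ i) has_real_derivative rotation \<omega> (q s) $ i * (if i = 1 then -1/2 else 1/2))
      (at s within T)" if "s \<in> T" for s i
  proof -
    have "((\<lambda>s. \<xi> s $ i) has_real_derivative
        - partial_deriv i (\<lambda>y. hamiltonian y (z s) (\<xi> s) \<omega>) (x s)) (at s within T)"
      using sol that \<theta>[OF that] unfolding hamiltonian_solution_def by auto
    moreover have "- partial_deriv i (\<lambda>y. hamiltonian y (z s) (\<xi> s) \<omega>) (x s)
        = rotation \<omega> (q s) $ i * (if i = 1 then -1/2 else 1/2)"
      using exhaust_4[of i]
      by (auto simp: partial_deriv_hamiltonian q_def p_def Let_def symbol_simps(1-4)[of _ 0 0] axis_def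
          rotation_def algebra_simps add_divide_distrib diff_divide_distrib)
    ultimately show ?thesis by simp
  qed
  \<comment> \<open>The first integral. One half of \<open>rotation \<omega> (x s)\<close> is the
    dependence of the symbols on \<open>x\<close>; the other half is what the momenta \<xi>
    accumulate, by \<open>d\<xi>\<close>. After the sign change in the first row both halves
    agree.\<close>
  have "((\<lambda>s. (q s - rotation \<omega> (x s)) $ i) has_real_derivative 0) (at s within T)"
    if "s \<in> T" for s i
  proof -
    have "(\<lambda>s. (q s - rotation \<omega> (x s)) $ i)
        = (\<lambda>s. (if i = 1 then -1 else 1) * \<xi> s $ i - 1/2 * rotation \<omega> (x s) $ i)"
      using exhaust_4[of i] by (auto simp: q_def p_def symbol_simps rotation_def algebra_simps add_divide_distrib diff_divide_distrib)
    moreover have "((\<lambda>s. rotation \<omega> (x s) $ i) has_real_derivative rotation \<omega> (q s) $ i) (at s within T)"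
      using that by (intro has_derivative_rotation dx)
    ultimately show ?thesis
      by (auto intro!: derivative_eq_intros d\<xi>[OF that])
  qed
  from interval_zero_derivative_const[OF T _ this]
  have q: "q s = rotation \<omega> (x s) + q 0" if "s \<in> T" for s
    unfolding vec_eq_iff
    using that by (simp add: \<open>x 0 = 0\<close> linear_0[OF bounded_linear.linear[OF bounded_linear_rotation]] diff_eq_eq)
  from is_interval_at_within_0_cases[OF T]
  have "((\<lambda>s. x s $ i) has_real_derivative u $ i) (at t within T) \<and>
    ((\<lambda>s. z s $ j) has_real_derivative vertical_velocity (x t) u $ j) (at t within T)"
  proof cases
    case 1
    then have "at t within T = bot"
      using \<open>t \<in> T\<close> by simp
    then show ?thesis
      by simp
  next
    case 2
    then have "q 0 = v"
      using has_field_derivative_unique[OF dx[OF T(2)] v] by (simp add: vec_eq_iff)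
    then have "q t = u"
      using q[OF \<open>t \<in> T\<close>] by (simp add: u_def \<omega>_def)
    then show ?thesis
      using dx[OF \<open>t \<in> T\<close>, of i] dz[OF \<open>t \<in> T\<close>, of j] by simp
  qed
  then show "((\<lambda>s. x s $ i) has_real_derivative u $ i) (at t within T)"
    and "((\<lambda>s. z s $ j) has_real_derivative vertical_velocity (x t) u $ j) (at t within T)"
    by simp_all
qed

end

section \<open>Coordinates adapted to the cross product\<close>

text \<open>
  The permutation and the sign turn \<open>rotation\<close> and \<open>vertical_velocity\<close> into expressions in the
  cross product of \<open>\<real>\<^sup>3\<close>.
\<close>

definition of_time_space :: "real \<Rightarrow> real^3 \<Rightarrow> real^4" where
  "of_time_space s Y = vector [s, - Y$1, Y$3, Y$2]"

lemma of_time_space_simps [simp]: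
  "of_time_space s Y $ 1 = s" "of_time_space s Y $ 2 = - Y$1" "of_time_space s Y $ 3 = Y$3" "of_time_space s Y $ 4 = Y$2"
  by (simp_all add: of_time_space_def)

lemma lorentz_sq_of_time_space: "lorentz_sq (of_time_space s Y) = Y \<bullet> Y - s\<^sup>2"
  by (simp add: lorentz_sq_def inner_vec_def sum_3 power2_eq_square)

lemma rotation_of_time_space: "rotation \<omega> (of_time_space s Y) = of_time_space (\<omega> \<bullet> Y) (s *\<^sub>R \<omega> + cross3 \<omega> Y)"
  by (simp add: vec_eq_iff forall_4 rotation_def cross3_simps inner_vec_def sum_3)

lemma vertical_velocity_of_time_space:
  "vertical_velocity (of_time_space s Y) (of_time_space s' Y') = (1/2) *\<^sub>R (s *\<^sub>R Y' - s' *\<^sub>R Y + cross3 Y Y')"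
  by (simp add: vec_eq_iff forall_3 vertical_velocity_def cross3_simps add_divide_distrib diff_divide_distrib)

lemma has_derivative_of_time_space:
  assumes "(s has_real_derivative s') (at t within T)"
    and "\<And>j. ((\<lambda>t. Y t $ j) has_real_derivative Y' $ j) (at t within T)"
  shows "((\<lambda>t. of_time_space (s t) (Y t) $ i) has_real_derivative of_time_space s' Y' $ i) (at t within T)"
proof -
  consider "i = 1" | "i = 2" | "i = 3" | "i = 4" using exhaust_4[of i] by blast
  then show ?thesis
    by cases (simp_all only: of_time_space_simps, (intro derivative_intros assms)+)
qed

section \<open>Explicit geodesics in an orthogonal frame\<close>

lemma height_norm_identity:
  fixes P N sn cs sh ch :: real
  assumes "sn\<^sup>2 + cs\<^sup>2 = 1" "ch\<^sup>2 - sh\<^sup>2 = 1"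
  shows "(1/2 * (- P * sh * sn + P * ch * cs + N * sh * cs - N * ch * sn
        + N * sh + P * ch - N * sn - P * cs - P))\<^sup>2
    + (1/2 * (N * sh * sn + N * ch * cs + P * sh * cs + P * ch * sn
        - P * sh - N * ch - P * sn + N * cs - N))\<^sup>2
    = - (((P + N) / 2)\<^sup>2 * (ch + sh) + ((P - N) / 2)\<^sup>2 * (ch - sh) - (P\<^sup>2 - N\<^sup>2) / 2)
      * (2 * sn * sh + 2 * cs - 2 * ch)"
proof -
  \<comment> \<open>As a quadratic form in \<open>P\<close> and \<open>N\<close>, the left side is
    \<open>K * ((ch - 1) * P^2 + 2 * sh * P * N + (ch + 1) * N^2)\<close>; the facts
    \<open>PP\<close>, \<open>NN\<close> and \<open>PN\<close> compute its coefficients. On the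
    right, the bracket is half of the form in parentheses and the last factor is
    \<open>- 2 * K\<close>.\<close>
  define K where "K = ch - cs - sn * sh"
  have PP: "(sh * sn - ch * cs - ch + cs + 1)\<^sup>2 + (sh * cs + ch * sn - sh - sn)\<^sup>2 = 4 * (ch - 1) * K"
    using assms unfolding K_def by algebra
  have NN: "(sh * cs - ch * sn + sh - sn)\<^sup>2 + (sh * sn + ch * cs - ch + cs - 1)\<^sup>2 = 4 * (ch + 1) * K"
    using assms unfolding K_def by algebra
  have PN: "(sh * sn + ch * cs - ch + cs - 1) * (sh * cs + ch * sn - sh - sn)
      - (sh * sn - ch * cs - ch + cs + 1) * (sh * cs - ch * sn + sh - sn) = 4 * sh * K"
    using assms unfolding K_def by algebra
  have sq: "(1/2 * (N * b - P * a))\<^sup>2 + (1/2 * (N * c + P * d))\<^sup>2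
      = 1/4 * (P\<^sup>2 * (a\<^sup>2 + d\<^sup>2) + N\<^sup>2 * (b\<^sup>2 + c\<^sup>2) + 2 * P * N * (c * d - a * b))" for a b c d
    by (simp add: power2_eq_square field_simps)
  from sq[of "sh * cs - ch * sn + sh - sn" "sh * sn - ch * cs - ch + cs + 1"
    "sh * sn + ch * cs - ch + cs - 1" "sh * cs + ch * sn - sh - sn"]
  show ?thesis
    unfolding PP NN PN unfolding K_def
    by (simp add: power2_eq_square field_simps)
qed

text \<open>\<open>P\<close>, \<open>N\<close> and \<open>F\<close> are the time, axial and
  transverse parts of the initial velocity divided by \<open>a\<close>; later
  \<open>P = c1 + c2\<close> and \<open>N = c1 - c2\<close>. Leaving \<open>F\<close> unnormalized
  admits \<open>F = 0\<close>, that is, geodesics without circular motion.\<close>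

locale geodesic_profile =
  fixes a P N :: real and n F :: "real^3"
  assumes unit: "n \<bullet> n = 1" and perp: "n \<bullet> F = 0"
begin

definition "G = cross3 n F"

lemma cross_frame: "cross3 n G = - F" "cross3 F G = (F \<bullet> F) *\<^sub>R n" "cross3 n F = G"
  "cross3 F n = - G" "cross3 G n = F" "cross3 G F = - (F \<bullet> F) *\<^sub>R n"
  using cross_skew[of G n] cross_skew[of G F] cross_skew[of F n]
  by (simp_all add: G_def Lagrange unit perp inner_commute[of F n])

lemma inner_frame: "n \<bullet> G = 0" "F \<bullet> G = 0" "G \<bullet> G = F \<bullet> F"
proof -
  show "n \<bullet> G = 0" "F \<bullet> G = 0"
    by (simp_all add: G_def dot_cross_self)
  show "G \<bullet> G = F \<bullet> F"
    using norm_cross[of n F] unit perp by (simp add: G_def power2_norm_eq_inner)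
qed

lemma inner_combination:
  "(m *\<^sub>R n + f *\<^sub>R F + g *\<^sub>R G) \<bullet> (m *\<^sub>R n + f *\<^sub>R F + g *\<^sub>R G)
    = m\<^sup>2 + F \<bullet> F * (f\<^sup>2 + g\<^sup>2)"
  by (simp add: inner_add_left inner_add_right inner_frame unit perp inner_commute[of F n]
      inner_commute[of G n] inner_commute[of G F] power2_eq_square algebra_simps)

text \<open>With \<open>s\<close> the time part and \<open>m\<close> the axial part, the system
  along \<open>n\<close> is \<open>s' = a * (m + P)\<close>, \<open>m' = a * (s + N)\<close>,
  because the cross product has no component there.\<close>

definition time_part where
  "time_part t = P * sinh (a * t) + N * (cosh (a * t) - 1)"

definition axial_part where
  "axial_part t = N * sinh (a * t) + P * (cosh (a * t) - 1)"

text \<open>The part orthogonal to \<open>n\<close> satisfies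
  \<open>y' = a * (n \<times> y + F)\<close> and runs from 0 on the circle with centre
  \<open>G\<close>.\<close>

definition space_part where
  "space_part t = axial_part t *\<^sub>R n + sin (a * t) *\<^sub>R F + (1 - cos (a * t)) *\<^sub>R G"

definition position where
  "position t = of_time_space (time_part t) (space_part t)"

definition initial_velocity where
  "initial_velocity = of_time_space (a * P) (a *\<^sub>R (N *\<^sub>R n + F))"

text \<open>The three heights integrate the frame components of the horizontality conditions along
  \<open>position\<close>, with constants chosen to vanish at 0. This one adds the signed areas
  swept by the hyperbolic and by the circular motion.\<close>

definition height_n where
  "height_n t = 1/2 * ((P\<^sup>2 - N\<^sup>2) * (sinh (a * t) - a * t) + F \<bullet> F * (a * t - sin (a * t)))"

definition height_F where
  "height_F t = 1/2 *
     (- P * sinh (a * t) * sin (a * t) + P * cosh (a * t) * cos (a * t)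
      + N * sinh (a * t) * cos (a * t) - N * cosh (a * t) * sin (a * t)
      + N * sinh (a * t) + P * cosh (a * t) - N * sin (a * t) - P * cos (a * t) - P)"

definition height_G where
  "height_G t = 1/2 *
     (N * sinh (a * t) * sin (a * t) + N * cosh (a * t) * cos (a * t)
      + P * sinh (a * t) * cos (a * t) + P * cosh (a * t) * sin (a * t)
      - P * sinh (a * t) - N * cosh (a * t) - P * sin (a * t) + N * cos (a * t) - N)"

definition height where
  "height t = height_n t *\<^sub>R n + height_F t *\<^sub>R F + height_G t *\<^sub>R G"

definition time_velocity where
  "time_velocity t = a * (P * cosh (a * t) + N * sinh (a * t))"

definition axial_velocity where
  "axial_velocity t = a * (N * cosh (a * t) + P * sinh (a * t))"

definition space_velocity where
  "space_velocity t = axial_velocity t *\<^sub>R n + (a * cos (a * t)) *\<^sub>R F + (a * sin (a * t)) *\<^sub>R G"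

lemma has_derivative_position:
  "((\<lambda>t. position t $ i) has_real_derivative of_time_space (time_velocity t) (space_velocity t) $ i) (at t within T)"
  unfolding position_def
proof (rule has_derivative_of_time_space)
  show "(time_part has_real_derivative time_velocity t) (at t within T)"
    unfolding time_part_def time_velocity_def
    by (auto intro!: derivative_eq_intros simp: algebra_simps)
  show "((\<lambda>t. space_part t $ j) has_real_derivative space_velocity t $ j) (at t within T)" for j
    unfolding space_part_def space_velocity_def axial_part_def axial_velocity_def
    by (auto intro!: derivative_eq_intros simp: algebra_simps)
qed

lemma velocity_position:
  "of_time_space (time_velocity t) (space_velocity t) = rotation (a *\<^sub>R n) (position t) + initial_velocity"
proof -
  have add: "of_time_space s Y + of_time_space s' Y' = of_time_space (s + s') (Y + Y')" for s s' Y Y'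
    by (simp add: vec_eq_iff forall_4)
  have axial: "n \<bullet> space_part t = axial_part t"
    by (simp add: space_part_def inner_add_right inner_frame unit perp)
  have cross: "cross3 n (space_part t) = sin (a * t) *\<^sub>R G - (1 - cos (a * t)) *\<^sub>R F"
    by (simp add: space_part_def cross_add_right cross_mult_right cross_frame)
  have "time_velocity t = a * axial_part t + a * P"
    by (simp add: time_velocity_def axial_part_def algebra_simps)
  moreover have "space_velocity t = (time_part t * a) *\<^sub>R n
      + a *\<^sub>R (sin (a * t) *\<^sub>R G - (1 - cos (a * t)) *\<^sub>R F) + a *\<^sub>R (N *\<^sub>R n + F)"
    unfolding space_velocity_def axial_velocity_def time_part_def
    by (simp add: vec_eq_iff algebra_simps)
  ultimately show ?thesis
    by (simp add: position_def initial_velocity_def rotation_of_time_space add axial cross cross_mult_left)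
qed

lemma cross_combination:
  "cross3 (m *\<^sub>R n + f *\<^sub>R F + g *\<^sub>R G) (m' *\<^sub>R n + f' *\<^sub>R F + g' *\<^sub>R G)
    = (F \<bullet> F * (f * g' - g * f')) *\<^sub>R n + (g * m' - m * g') *\<^sub>R F + (m * f' - f * m') *\<^sub>R G"
  by (simp add: cross_mult_left cross_mult_right cross_add_right cross_add_left cross_frame
      vec_eq_iff algebra_simps)

lemma vertical_velocity_combination:
  "vertical_velocity (of_time_space s (m *\<^sub>R n + f *\<^sub>R F + g *\<^sub>R G))
      (of_time_space s' (m' *\<^sub>R n + f' *\<^sub>R F + g' *\<^sub>R G))
    = (1/2 * (s * m' - s' * m + F \<bullet> F * (f * g' - g * f'))) *\<^sub>R n
      + (1/2 * (s * f' - s' * f - m * g' + g * m')) *\<^sub>R F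
      + (1/2 * (s * g' - s' * g + m * f' - f * m')) *\<^sub>R G"
  unfolding vertical_velocity_of_time_space cross_combination
  by (simp add: vec_eq_iff algebra_simps add_divide_distrib diff_divide_distrib)

lemma has_derivative_height:
  "((\<lambda>t. height t $ j) has_real_derivative
    vertical_velocity (position t) (rotation (a *\<^sub>R n) (position t) + initial_velocity) $ j) (at t within T)"
proof -
  let ?s = "time_part t" and ?s' = "time_velocity t" and ?m = "axial_part t" and ?m' = "axial_velocity t"
  define hn where "hn = 1/2 * (?s * ?m' - ?s' * ?m
    + F \<bullet> F * (sin (a * t) * (a * sin (a * t)) - (1 - cos (a * t)) * (a * cos (a * t))))"
  define hF where "hF = 1/2 * (?s * (a * cos (a * t)) - ?s' * sin (a * t)
    - ?m * (a * sin (a * t)) + (1 - cos (a * t)) * ?m')"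
  define hG where "hG = 1/2 * (?s * (a * sin (a * t)) - ?s' * (1 - cos (a * t))
    + ?m * (a * cos (a * t)) - sin (a * t) * ?m')"
  have dn: "(height_n has_real_derivative hn) (at t within T)"
  proof -
    \<comment> \<open>Only the axial component needs the two Pythagorean identities; along
      \<open>F\<close> and \<open>G\<close> the product rule suffices.\<close>
    have hn_eq: "hn = 1/2 * ((P\<^sup>2 - N\<^sup>2) * (cosh (a * t) * a - a) + F \<bullet> F * (a - cos (a * t) * a))"
    proof -
      have "sin (a * t) ^ 2 + cos (a * t) ^ 2 = 1" "cosh (a * t) ^ 2 - sinh (a * t) ^ 2 = 1"
        by (simp_all add: hyperbolic_pythagoras)
      then show ?thesis
        unfolding hn_def time_part_def time_velocity_def axial_part_def axial_velocity_def
        by algebra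
    qed
    have "(height_n has_real_derivative
        1/2 * ((P\<^sup>2 - N\<^sup>2) * (cosh (a * t) * a - a) + F \<bullet> F * (a - cos (a * t) * a))) (at t within T)"
      unfolding height_n_def by (auto intro!: derivative_eq_intros)
    then show ?thesis
      unfolding hn_eq .
  qed
  have dF: "(height_F has_real_derivative hF) (at t within T)"
    unfolding height_F_def hF_def time_part_def time_velocity_def axial_part_def axial_velocity_def
    by (auto intro!: derivative_eq_intros simp: algebra_simps add_divide_distrib diff_divide_distrib)
  have dG: "(height_G has_real_derivative hG) (at t within T)"
    unfolding height_G_def hG_def time_part_def time_velocity_def axial_part_def axial_velocity_def
    by (auto intro!: derivative_eq_intros simp: algebra_simps add_divide_distrib diff_divide_distrib)
  have "vertical_velocity (position t) (of_time_space ?s' (space_velocity t))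
      = hn *\<^sub>R n + hF *\<^sub>R F + hG *\<^sub>R G"
    unfolding position_def space_part_def space_velocity_def hn_def hF_def hG_def
    by (rule vertical_velocity_combination)
  then show ?thesis
    unfolding velocity_position[symmetric] height_def vector_add_component vector_scaleR_component real_scaleR_def
    by (simp only: vector_add_component vector_scaleR_component real_scaleR_def)
      (intro DERIV_add DERIV_cmult_right dn dF dG)
qed

lemma position_0: "position 0 = 0" and height_0: "height 0 = 0"
  by (simp_all add: position_def time_part_def space_part_def axial_part_def vec_eq_iff forall_4
      height_def height_n_def height_F_def height_G_def)

text \<open>The difference of two solutions for \<open>x\<close> solves the homogeneous linear
  equation with initial value 0. Once \<open>x\<close> is known, \<open>z\<close> is determined by
  its derivative.\<close>

lemma geodesic_unique:
  fixes x :: "real \<Rightarrow> real^4" and z :: "real \<Rightarrow> real^3"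
  assumes T: "is_interval T" "0 \<in> T" and "t \<in> T" and "x 0 = 0" "z 0 = 0"
    and x: "\<And>s i. s \<in> T \<Longrightarrow> ((\<lambda>s. x s $ i) has_real_derivative
      (rotation (a *\<^sub>R n) (x s) + initial_velocity) $ i) (at s within T)"
    and z: "\<And>s j. s \<in> T \<Longrightarrow> ((\<lambda>s. z s $ j) has_real_derivative
      vertical_velocity (x s) (rotation (a *\<^sub>R n) (x s) + initial_velocity) $ j) (at s within T)"
  shows "x t = position t" and "z t = height t"
proof -
  have x_eq: "x s = position s" if "s \<in> T" for s
  proof -
    interpret rot: bounded_linear "rotation (a *\<^sub>R n)"
      by (rule bounded_linear_rotation)
    have "((\<lambda>s. (x s - position s) $ i) has_real_derivative
        rotation (a *\<^sub>R n) (x s - position s) $ i) (at s within T)" if "s \<in> T" for s i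
      using DERIV_diff[OF x[OF that, of i] has_derivative_position[of i s T]]
      by (simp add: velocity_position rot.diff)
    from linear_ode_zero[OF T that bounded_linear_rotation this] show ?thesis
      by (simp add: \<open>x 0 = 0\<close> position_0)
  qed
  then show "x t = position t" using \<open>t \<in> T\<close> .
  have "((\<lambda>s. z s $ j - height s $ j) has_real_derivative 0) (at s within T)" if "s \<in> T" for s j
    using DERIV_diff[OF z[OF that, of j] has_derivative_height[of j s T]] x_eq[OF that] by simp
  from interval_zero_derivative_const[OF T \<open>t \<in> T\<close> this]
  show "z t = height t"
    by (simp add: vec_eq_iff \<open>z 0 = 0\<close> height_0)
qed

text \<open>The frame separates the form into a hyperbolic and a circular contribution. The latter
  is the squared length of a chord of the circle, which produces the half angle; the former is its
  hyperbolic analogue.\<close>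

lemma lorentz_sq_position:
  "lorentz_sq (position t) = - 4 * (P\<^sup>2 - N\<^sup>2) * (sinh (a * t / 2))\<^sup>2 + 4 * (F \<bullet> F) * (sin (a * t / 2))\<^sup>2"
proof -
  define r where "r = a * t / 2"
  have r: "a * t = 2 * r"
    by (simp add: r_def)
  have space: "space_part t \<bullet> space_part t
      = (axial_part t)\<^sup>2 + F \<bullet> F * ((sin (a * t))\<^sup>2 + (1 - cos (a * t))\<^sup>2)"
    unfolding space_part_def by (rule inner_combination)
  have "sin (2 * r) = 2 * sin r * cos r" "cos (2 * r) = 1 - 2 * (sin r)\<^sup>2"
    "(sin r)\<^sup>2 + (cos r)\<^sup>2 = 1"
    by (simp_all add: sin_double cos_double_sin)
  then have trig: "(sin (2 * r))\<^sup>2 + (1 - cos (2 * r))\<^sup>2 = 4 * (sin r)\<^sup>2"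
    by algebra
  have "sinh (2 * r) = 2 * sinh r * cosh r" "cosh (2 * r) = 1 + 2 * (sinh r)\<^sup>2"
    "(cosh r)\<^sup>2 = (sinh r)\<^sup>2 + 1"
    by (simp_all add: sinh_double cosh_double cosh_square_eq)
  then have hyp: "(axial_part t)\<^sup>2 - (time_part t)\<^sup>2 = - 4 * (P\<^sup>2 - N\<^sup>2) * (sinh r)\<^sup>2"
    unfolding axial_part_def time_part_def r by algebra
  have "lorentz_sq (position t) = ((axial_part t)\<^sup>2 - (time_part t)\<^sup>2)
      + F \<bullet> F * ((sin (2 * r))\<^sup>2 + (1 - cos (2 * r))\<^sup>2)"
    unfolding position_def lorentz_sq_of_time_space space r by simp
  then show ?thesis
    unfolding hyp trig r_def[symmetric] by (simp add: mult.commute)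
qed

lemma height_norm:
  "height t \<bullet> height t = (height_n t)\<^sup>2 + F \<bullet> F * ((height_F t)\<^sup>2 + (height_G t)\<^sup>2)"
  unfolding height_def by (rule inner_combination)

lemma height_FG_norm:
  "(height_F t)\<^sup>2 + (height_G t)\<^sup>2 =
     - (((P + N) / 2)\<^sup>2 * exp (a * t) + ((P - N) / 2)\<^sup>2 * exp (- (a * t)) - (P\<^sup>2 - N\<^sup>2) / 2)
     * (2 * sin (a * t) * sinh (a * t) + 2 * cos (a * t) - 2 * cosh (a * t))"
proof -
  have e: "exp (a * t) = cosh (a * t) + sinh (a * t)" "exp (- (a * t)) = cosh (a * t) - sinh (a * t)"
    by (simp_all add: cosh_def sinh_def field_simps)
  have "sin (a * t) ^ 2 + cos (a * t) ^ 2 = 1" "cosh (a * t) ^ 2 - sinh (a * t) ^ 2 = 1"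
    by (simp_all add: hyperbolic_pythagoras)
  then show ?thesis
    unfolding e height_F_def height_G_def
    by (rule height_norm_identity)
qed

end

section \<open>Identification of the parameters and coefficients\<close>

context
  fixes \<omega> :: "real^3" and v :: "real^4"
  assumes nondegenerate: "(\<omega>$1)\<^sup>2 + (\<omega>$2)\<^sup>2 \<noteq> 0"
begin

lemma par_a_square: "(par_a \<omega>)\<^sup>2 = (\<omega>$1)\<^sup>2 + (\<omega>$2)\<^sup>2 + (\<omega>$3)\<^sup>2"
  by (simp add: par_a_def)

lemma par_a_pos: "par_a \<omega> > 0"
  using nondegenerate unfolding par_a_def
  by (smt (verit) real_sqrt_gt_zero zero_le_power2)

definition axial_direction :: "real^3" where
  "axial_direction = (1 / par_a \<omega>) *\<^sub>R \<omega>"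

text \<open>In \<open>space_part\<close> the factor of the sine is \<open>F\<close>, so
  \<open>F\<close> is chosen such that \<open>of_time_space 0 F\<close> is
  \<open>coeff_C\<close>.\<close>

definition transverse :: "real^3" where
  "transverse = vector [- coeff_C \<omega> v $ 2, coeff_C \<omega> v $ 4, coeff_C \<omega> v $ 3]"

lemma axial_direction_unit: "axial_direction \<bullet> axial_direction = 1"
proof -
  have "\<omega> \<bullet> \<omega> = (par_a \<omega>)\<^sup>2"
    unfolding par_a_square by (simp add: inner_vec_def sum_3 power2_eq_square)
  then show ?thesis
    using par_a_pos by (simp add: axial_direction_def power2_eq_square)
qed

lemma axial_direction_perp: "axial_direction \<bullet> transverse = 0"
  using par_a_pos
  by (simp add: axial_direction_def transverse_def inner_vec_def sum_3 coeff_C_def Let_def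
      field_simps power2_eq_square)

interpretation geodesic_profile "par_a \<omega>" "par_c1 \<omega> v + par_c2 \<omega> v" "par_c1 \<omega> v - par_c2 \<omega> v"
  axial_direction transverse
  by unfold_locales (rule axial_direction_unit axial_direction_perp)+

text \<open>The factor of the cosine in \<open>space_part\<close> is \<open>- G\<close>, and this
  says that \<open>of_time_space 0 (- G)\<close> is \<open>coeff_D\<close>. Multiplying by
  \<open>a * a\<close> clears the denominators and leaves polynomial identities modulo the formula
  for \<open>a^2\<close>.\<close>

lemma transverse_rotated: "G = vector [coeff_D \<omega> v $ 2, - coeff_D \<omega> v $ 4, - coeff_D \<omega> v $ 3]"
proof -
  define a c3 c4 where abs: "a = par_a \<omega>" "c3 = par_c3 \<omega> v" "c4 = par_c4 \<omega> v"
  have a: "a\<^sup>2 = (\<omega>$1)\<^sup>2 + (\<omega>$2)\<^sup>2 + (\<omega>$3)\<^sup>2" "a \<noteq> 0"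
    using par_a_square par_a_pos by (simp_all add: abs)
  have G: "(a * a) *\<^sub>R G = cross3 \<omega> (a *\<^sub>R transverse)"
    using a(2) unfolding G_def by (simp add: axial_direction_def cross_mult_left cross_mult_right abs)
  have F: "a *\<^sub>R transverse = vector [- (2 * (c3 * \<omega>$1 * \<omega>$3 - c4 * a * \<omega>$2)),
      - (2 * (c4 * a * \<omega>$1 + c3 * \<omega>$2 * \<omega>$3)), 2 * c3 * ((\<omega>$1)\<^sup>2 + (\<omega>$2)\<^sup>2)]"
    using a(2) by (simp add: vec_eq_iff forall_3 transverse_def coeff_C_def Let_def abs[symmetric])
  have D: "(a * a) *\<^sub>R vector [coeff_D \<omega> v $ 2, - coeff_D \<omega> v $ 4, - coeff_D \<omega> v $ 3]
     = (vector [a * (2 * (c4 * \<omega>$1 * \<omega>$3 + c3 * a * \<omega>$2)),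
      - (a * (2 * (c3 * a * \<omega>$1 - c4 * \<omega>$2 * \<omega>$3))), - (a * (2 * c4 * ((\<omega>$1)\<^sup>2 + (\<omega>$2)\<^sup>2)))] :: real^3)"
    using a(2) by (simp add: vec_eq_iff forall_3 coeff_D_def Let_def abs[symmetric])
  have "\<omega>$2 * (2 * c3 * ((\<omega>$1)\<^sup>2 + (\<omega>$2)\<^sup>2)) - \<omega>$3 * - (2 * (c4 * a * \<omega>$1 + c3 * \<omega>$2 * \<omega>$3))
      = a * (2 * (c4 * \<omega>$1 * \<omega>$3 + c3 * a * \<omega>$2))"
    "\<omega>$3 * - (2 * (c3 * \<omega>$1 * \<omega>$3 - c4 * a * \<omega>$2)) - \<omega>$1 * (2 * c3 * ((\<omega>$1)\<^sup>2 + (\<omega>$2)\<^sup>2))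
      = - (a * (2 * (c3 * a * \<omega>$1 - c4 * \<omega>$2 * \<omega>$3)))"
    "\<omega>$1 * - (2 * (c4 * a * \<omega>$1 + c3 * \<omega>$2 * \<omega>$3)) - \<omega>$2 * - (2 * (c3 * \<omega>$1 * \<omega>$3 - c4 * a * \<omega>$2))
      = - (a * (2 * c4 * ((\<omega>$1)\<^sup>2 + (\<omega>$2)\<^sup>2)))"
    by (use a(1) in algebra, use a(1) in algebra, simp add: power2_eq_square algebra_simps)
  then have "(a * a) *\<^sub>R G = (a * a) *\<^sub>R vector [coeff_D \<omega> v $ 2, - coeff_D \<omega> v $ 4, - coeff_D \<omega> v $ 3]"
    unfolding G F D vec_eq_iff forall_3 cross3_def vector_3 by blast
  then show ?thesis
    using a(2) unfolding scaleR_cancel_left by simp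
qed

lemma transverse_inner: "transverse \<bullet> transverse = 4 * par_k \<omega> v"
proof -
  define a c3 c4 where abs: "a = par_a \<omega>" "c3 = par_c3 \<omega> v" "c4 = par_c4 \<omega> v"
  have a: "a\<^sup>2 = (\<omega>$1)\<^sup>2 + (\<omega>$2)\<^sup>2 + (\<omega>$3)\<^sup>2" "a \<noteq> 0"
    using par_a_square par_a_pos by (simp_all add: abs)
  have "a\<^sup>2 * (transverse \<bullet> transverse) = (2 * (c3 * \<omega>$1 * \<omega>$3 - c4 * a * \<omega>$2))\<^sup>2
     + (2 * (c4 * a * \<omega>$1 + c3 * \<omega>$2 * \<omega>$3))\<^sup>2 + (2 * c3 * ((\<omega>$1)\<^sup>2 + (\<omega>$2)\<^sup>2))\<^sup>2"
    using a(2)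
    by (simp add: transverse_def inner_vec_def sum_3 coeff_C_def Let_def abs[symmetric]
      field_simps power2_eq_square)
  also have "\<dots> = a\<^sup>2 * (4 * par_k \<omega> v)"
    using a(1) unfolding par_k_def abs[symmetric] by algebra
  finally show ?thesis
    using a(2) by simp
qed

text \<open>The definitions of \<open>c1\<close> to \<open>c4\<close> invert the decomposition of
  \<open>v\<close> along the frame. Cleared of the nonzero denominators, each component is a
  polynomial identity modulo \<open>a^2 = b + \<omega>$3^2\<close>.\<close>

lemma initial_velocity_eq: "initial_velocity = v"
proof -
  define a b c1 c2 c3 c4 where abs: "a = par_a \<omega>" "b = (\<omega>$1)\<^sup>2 + (\<omega>$2)\<^sup>2"
    "c1 = par_c1 \<omega> v" "c2 = par_c2 \<omega> v" "c3 = par_c3 \<omega> v" "c4 = par_c4 \<omega> v"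
  have a: "a\<^sup>2 = b + (\<omega>$3)\<^sup>2" "a \<noteq> 0" "b \<noteq> 0"
    using par_a_square par_a_pos nondegenerate by (simp_all add: abs)
  have c: "2 * a\<^sup>2 * c1 = a * v$1 - \<omega>$1 * v$2 + \<omega>$3 * v$3 + \<omega>$2 * v$4"
    "2 * a\<^sup>2 * c2 = a * v$1 + \<omega>$1 * v$2 - \<omega>$3 * v$3 - \<omega>$2 * v$4"
    "2 * a\<^sup>2 * b * c3 = \<omega>$1 * \<omega>$3 * v$2 + b * v$3 - \<omega>$2 * \<omega>$3 * v$4"
    "2 * a * b * c4 = - (\<omega>$2 * v$2 + \<omega>$1 * v$4)"
    using a(2,3) unfolding abs(3-6) par_c1_def par_c2_def par_c3_def par_c4_def Let_def abs(1,2)[symmetric]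
    by simp_all
  have nz: "a\<^sup>2 \<noteq> 0" "a\<^sup>2 * b \<noteq> 0"
    using a(2,3) by simp_all
  have v1: "a\<^sup>2 * (a * (c1 + c2)) = a\<^sup>2 * v$1"
    using c(1,2) by algebra
  have v2: "(a\<^sup>2 * b) * (- \<omega>$1 * (c1 - c2) + 2 * (c3 * \<omega>$1 * \<omega>$3 - c4 * a * \<omega>$2)) = (a\<^sup>2 * b) * v$2"
    using c a(1) abs(2) by algebra
  have v3: "(a\<^sup>2 * b) * (\<omega>$3 * (c1 - c2) + 2 * c3 * b) = (a\<^sup>2 * b) * v$3"
    using c a(1) abs(2) by algebra
  have v4: "(a\<^sup>2 * b) * (\<omega>$2 * (c1 - c2) - 2 * (c4 * a * \<omega>$1 + c3 * \<omega>$2 * \<omega>$3)) = (a\<^sup>2 * b) * v$4"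
    using c a(1) abs(2) by algebra
  have F: "a *\<^sub>R transverse = vector [- (2 * (c3 * \<omega>$1 * \<omega>$3 - c4 * a * \<omega>$2)),
      - (2 * (c4 * a * \<omega>$1 + c3 * \<omega>$2 * \<omega>$3)), 2 * c3 * b]"
    using a(2) by (simp add: vec_eq_iff forall_3 transverse_def coeff_C_def Let_def abs[symmetric])
  have "initial_velocity = of_time_space (a * (c1 + c2)) ((c1 - c2) *\<^sub>R \<omega> + a *\<^sub>R transverse)"
    using a(2) unfolding initial_velocity_def
    by (simp add: axial_direction_def abs scaleR_add_right)
  also have "\<dots> = v"
    using v1 v2 v3 v4 unfolding mult_left_cancel[OF nz(1)] mult_left_cancel[OF nz(2)] F
    by (simp add: vec_eq_iff forall_4 algebra_simps)
  finally show ?thesis .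
qed

text \<open>In frame coordinates the Lorentzian square of \<open>v\<close> is
  \<open>a^2 * (N^2 + 4 * k - P^2)\<close>, and \<open>P^2 - N^2 = 4 * c1 * c2\<close>.\<close>

lemma par_c1_c2_k: "- par_c1 \<omega> v * par_c2 \<omega> v + par_k \<omega> v = 1 / (4 * (par_a \<omega>)\<^sup>2) * lorentz_sq v"
proof -
  define N where "N = par_c1 \<omega> v - par_c2 \<omega> v"
  have "(N *\<^sub>R axial_direction + transverse) \<bullet> (N *\<^sub>R axial_direction + transverse)
      = N\<^sup>2 + 4 * par_k \<omega> v"
    using inner_combination[of N 1 0] by (simp add: transverse_inner)
  then have "lorentz_sq initial_velocity = (par_a \<omega>)\<^sup>2 * (N\<^sup>2 + 4 * par_k \<omega> v) - (par_a \<omega> * (par_c1 \<omega> v + par_c2 \<omega> v))\<^sup>2"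
    unfolding initial_velocity_def lorentz_sq_of_time_space unfolding N_def[symmetric]
    by (simp add: power2_eq_square)
  then show ?thesis
    using par_a_pos unfolding initial_velocity_eq N_def
    by (simp add: field_simps power2_eq_square)
qed

text \<open>This reduces the comparison with \<open>height\<close> to scalar coefficients. Each
  \<beta> pairs one of \<open>alpha1\<close>, \<open>alpha2\<close> (along \<open>F\<close>) with
  one of \<open>alpha3\<close>, \<open>alpha4\<close> (along \<open>G\<close>), which matches the
  mixed products in \<open>height_F\<close> and \<open>height_G\<close>.\<close>

lemma alpha_frame:
  fixes c1 c2 k P N
  defines "c1 \<equiv> par_c1 \<omega> v" and "c2 \<equiv> par_c2 \<omega> v" and "k \<equiv> par_k \<omega> v"
  defines "P \<equiv> c1 + c2" and "N \<equiv> c1 - c2"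
  shows "alpha0 \<omega> v = (2 * (k - c1 * c2)) *\<^sub>R axial_direction"
    and "alpha1 \<omega> v = (- 2 * P) *\<^sub>R transverse"
    and "alpha2 \<omega> v = (- 2 * N) *\<^sub>R transverse"
    and "alpha3 \<omega> v = (2 * P) *\<^sub>R G"
    and "alpha4 \<omega> v = (2 * N) *\<^sub>R G"
    and "alpha5 \<omega> v = (4 * c1 * c2) *\<^sub>R axial_direction + N *\<^sub>R transverse - P *\<^sub>R G"
    and "alpha6 \<omega> v = P *\<^sub>R transverse - N *\<^sub>R G"
    and "alpha7 \<omega> v = (- 4 * k) *\<^sub>R axial_direction - N *\<^sub>R transverse - P *\<^sub>R G"
  using par_a_pos
  unfolding transverse_rotated
  unfolding alpha0_def alpha1_def alpha2_def alpha3_def alpha4_def alpha5_def alpha6_def alpha7_def Let_def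
    transverse_def axial_direction_def coeff_C_def coeff_D_def
    c1_def[symmetric] c2_def[symmetric] k_def[symmetric] P_def[symmetric] N_def[symmetric]
  by (simp_all add: vec_eq_iff forall_3 field_simps)

lemma position_coefficients:
  fixes t defines "a \<equiv> par_a \<omega>"
  shows "position t $ 1 = coeff_A \<omega> v $ 1 * sinh (a * t) + coeff_B \<omega> v $ 1 * cosh (a * t) + coeff_E \<omega> v $ 1"
    and "j \<in> {2, 3, 4} \<Longrightarrow> position t $ j = coeff_A \<omega> v $ j * sinh (a * t) + coeff_B \<omega> v $ j * cosh (a * t)
            + coeff_C \<omega> v $ j * sin (a * t) + coeff_D \<omega> v $ j * cos (a * t) + coeff_E \<omega> v $ j"
proof -
  show "position t $ 1 = coeff_A \<omega> v $ 1 * sinh (a * t) + coeff_B \<omega> v $ 1 * cosh (a * t) + coeff_E \<omega> v $ 1"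
    unfolding a_def
    by (simp add: position_def time_part_def coeff_A_def coeff_B_def coeff_E_def Let_def algebra_simps)
  assume "j \<in> {2, 3, 4}"
  \<comment> \<open>The constant terms are the ones that give \<open>x(0) = 0\<close>.\<close>
  moreover have E: "coeff_E \<omega> v $ i = - coeff_B \<omega> v $ i - coeff_D \<omega> v $ i" if "i \<in> {2, 3, 4}" for i
    using that by (auto simp: coeff_B_def coeff_D_def coeff_E_def Let_def)
  have A: "(par_c1 \<omega> v - par_c2 \<omega> v) * axial_direction $ 1 = - coeff_A \<omega> v $ 2"
    "(par_c1 \<omega> v - par_c2 \<omega> v) * axial_direction $ 2 = coeff_A \<omega> v $ 4"
    "(par_c1 \<omega> v - par_c2 \<omega> v) * axial_direction $ 3 = coeff_A \<omega> v $ 3"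
    "(par_c1 \<omega> v + par_c2 \<omega> v) * axial_direction $ 1 = - coeff_B \<omega> v $ 2"
    "(par_c1 \<omega> v + par_c2 \<omega> v) * axial_direction $ 2 = coeff_B \<omega> v $ 4"
    "(par_c1 \<omega> v + par_c2 \<omega> v) * axial_direction $ 3 = coeff_B \<omega> v $ 3"
    using par_a_pos
    by (simp_all add: axial_direction_def coeff_A_def coeff_B_def Let_def field_simps)
  have "space_part t $ i = (par_c1 \<omega> v - par_c2 \<omega> v) * axial_direction $ i * sinh (a * t)
      + (par_c1 \<omega> v + par_c2 \<omega> v) * axial_direction $ i * (cosh (a * t) - 1)
      + transverse $ i * sin (a * t) + G $ i * (1 - cos (a * t))" for i
    unfolding space_part_def axial_part_def a_def by (simp add: algebra_simps)
  note sp = this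
  have FG: "transverse $ 1 = - coeff_C \<omega> v $ 2" "transverse $ 2 = coeff_C \<omega> v $ 4"
    "transverse $ 3 = coeff_C \<omega> v $ 3" "G $ 1 = coeff_D \<omega> v $ 2" "G $ 2 = - coeff_D \<omega> v $ 4"
    "G $ 3 = - coeff_D \<omega> v $ 3"
    unfolding transverse_rotated unfolding transverse_def by simp_all
  ultimately show "position t $ j = coeff_A \<omega> v $ j * sinh (a * t) + coeff_B \<omega> v $ j * cosh (a * t)
            + coeff_C \<omega> v $ j * sin (a * t) + coeff_D \<omega> v $ j * cos (a * t) + coeff_E \<omega> v $ j"
    by (auto simp: position_def sp[of 1, unfolded A FG] sp[of 2, unfolded A FG]
        sp[of 3, unfolded A FG] E algebra_simps)
qed

text \<open>The factor \<open>1/2\<close> before \<open>alpha5\<close> to \<open>alpha8\<close> is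
  that of horizontality: along \<open>n\<close>, for instance, \<open>sinh\<close> has coefficient
  \<open>2 * c1 * c2\<close> in \<open>height_n\<close> but \<open>4 * c1 * c2\<close> in
  \<open>alpha5\<close>.\<close>

lemma height_coefficients:
  fixes t defines "a \<equiv> par_a \<omega>"
  shows "height t $ i = a * alpha0 \<omega> v $ i * t
            + beta1 \<omega> v $ i * sinh (a * t) * sin (a * t) + beta2 \<omega> v $ i * cosh (a * t) * cos (a * t)
            + beta3 \<omega> v $ i * sinh (a * t) * cos (a * t) + beta4 \<omega> v $ i * cosh (a * t) * sin (a * t)
            + 1/2 * (alpha5 \<omega> v $ i * sinh (a * t) + alpha6 \<omega> v $ i * cosh (a * t)
                     + alpha7 \<omega> v $ i * sin (a * t) + alpha8 \<omega> v $ i * cos (a * t))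
            - beta2 \<omega> v $ i"
proof -
  have "((c1 + c2)\<^sup>2 - (c1 - c2)\<^sup>2) = 4 * c1 * c2" for c1 c2 :: real
    by algebra
  then show ?thesis
    unfolding a_def height_def height_n_def height_F_def height_G_def beta1_def beta2_def beta3_def
      beta4_def alpha8_def alpha_frame transverse_inner
    by (simp add: algebra_simps add_divide_distrib diff_divide_distrib)
qed

text \<open>The first square is that of \<open>height_n\<close>. The other two summands are
  \<open>4 * k\<close> times the formula of \<open>height_FG_norm\<close>, where
  \<open>(P + N) / 2 = c1\<close> and \<open>(P - N) / 2 = c2\<close>.\<close>

lemma height_norm_parameters:
  fixes t a c1 c2 k
  defines "a \<equiv> par_a \<omega>" and "c1 \<equiv> par_c1 \<omega> v" and "c2 \<equiv> par_c2 \<omega> v" and "k \<equiv> par_k \<omega> v"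
  shows "(height t $ 1)\<^sup>2 + (height t $ 2)\<^sup>2 + (height t $ 3)\<^sup>2
    = 4 * (a * t * (- c1 * c2 + k) + c1 * c2 * sinh (a * t) - k * sin (a * t))\<^sup>2
      - 4 * k * (c1\<^sup>2 * exp (a * t) + c2\<^sup>2 * exp (- (a * t)))
          * (2 * sin (a * t) * sinh (a * t) + 2 * cos (a * t) - 2 * cosh (a * t))
      + 8 * c1 * c2 * k
          * (2 * sin (a * t) * sinh (a * t) + 2 * cos (a * t) - 2 * cosh (a * t))"
proof -
  have sq: "(c1 + c2)\<^sup>2 - (c1 - c2)\<^sup>2 = 4 * c1 * c2"
    by algebra
  have "(height t $ 1)\<^sup>2 + (height t $ 2)\<^sup>2 + (height t $ 3)\<^sup>2 = height t \<bullet> height t"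
    by (simp add: inner_vec_def sum_3 power2_eq_square)
  also have "\<dots> = (1/2 * (4 * c1 * c2 * (sinh (a * t) - a * t) + 4 * k * (a * t - sin (a * t))))\<^sup>2
      + 4 * k * (- (((c1 + c2 + (c1 - c2)) / 2)\<^sup>2 * exp (a * t)
          + ((c1 + c2 - (c1 - c2)) / 2)\<^sup>2 * exp (- (a * t)) - 4 * c1 * c2 / 2)
        * (2 * sin (a * t) * sinh (a * t) + 2 * cos (a * t) - 2 * cosh (a * t)))"
    unfolding height_norm height_FG_norm height_n_def transverse_inner
    unfolding a_def[symmetric] c1_def[symmetric] c2_def[symmetric] k_def[symmetric] sq ..
  finally show ?thesis
    by (simp add: power2_eq_square algebra_simps)
qed

lemma lorentz_sq_position_parameters:
  fixes t a defines "a \<equiv> par_a \<omega>"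
  shows "- (position t $ 1)\<^sup>2 + (position t $ 2)\<^sup>2 + (position t $ 3)\<^sup>2 + (position t $ 4)\<^sup>2
    = - 16 * par_c1 \<omega> v * par_c2 \<omega> v * (sinh (a * t / 2))\<^sup>2 + 16 * par_k \<omega> v * (sin (a * t / 2))\<^sup>2"
proof -
  have "(c1 + c2)\<^sup>2 - (c1 - c2)\<^sup>2 = 4 * c1 * c2" for c1 c2 :: real
    by algebra
  then show ?thesis
    using lorentz_sq_position[of t] unfolding transverse_inner lorentz_sq_def a_def by simp
qed

lemma geodesic_eq:
  fixes x :: "real \<Rightarrow> real^4" and z :: "real \<Rightarrow> real^3"
  assumes T: "is_interval T" "0 \<in> T" and "t \<in> T" and "x 0 = 0" "z 0 = 0"
    and x: "\<And>s i. s \<in> T \<Longrightarrow> ((\<lambda>s. x s $ i) has_real_derivative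
      (rotation \<omega> (x s) + v) $ i) (at s within T)"
    and z: "\<And>s j. s \<in> T \<Longrightarrow> ((\<lambda>s. z s $ j) has_real_derivative
      vertical_velocity (x s) (rotation \<omega> (x s) + v) $ j) (at s within T)"
  shows "x t = position t" and "z t = height t"
proof -
  have "par_a \<omega> *\<^sub>R axial_direction = \<omega>"
    using par_a_pos by (simp add: axial_direction_def)
  then show "x t = position t" and "z t = height t"
    using geodesic_unique[of T t x z] assms by (simp_all add: initial_velocity_eq)
qed

lemmas geodesic_formulas = geodesic_eq position_coefficients height_coefficients
  lorentz_sq_position_parameters height_norm_parameters par_c1_c2_k

end

text \<open>A check of the last quadratic identity: horizontality is antisymmetric in position and
  velocity, so \<open>z\<close> is of third order at \<open>t = 0\<close> and its square norm of
  sixth order. The right side respects this, whereas the coefficients 2, 4 and 5 of the informal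
  formula would in general leave a term of second order.\<close>

theorem mainTheorem7:
  fixes T :: "real set"
    and x \<xi> :: "real \<Rightarrow> real^4"
    and z \<theta> :: "real \<Rightarrow> real^3"
    and v :: "real^4"
  assumes "is_interval T" and "0 \<in> T"
    and "hamiltonian_solution T x z \<xi> \<theta>"
    and "x 0 = 0" and "z 0 = 0"
    and "\<And>i. ((\<lambda>t. x t $ i) has_real_derivative v $ i) (at 0 within T)"
    and "(\<theta> 0 $ 1)\<^sup>2 + (\<theta> 0 $ 2)\<^sup>2 \<noteq> 0"
  shows "(\<forall>t\<in>T. \<theta> t = \<theta> 0) \<and>
    (let \<omega> = \<theta> 0; a = par_a \<omega>; c1 = par_c1 \<omega> v; c2 = par_c2 \<omega> v; k = par_k \<omega> v in
      (\<forall>t\<in>T.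
         x t $ 1 = coeff_A \<omega> v $ 1 * sinh (a * t) + coeff_B \<omega> v $ 1 * cosh (a * t) + coeff_E \<omega> v $ 1 \<and>
         (\<forall>j\<in>{2, 3, 4}. x t $ j =
            coeff_A \<omega> v $ j * sinh (a * t) + coeff_B \<omega> v $ j * cosh (a * t)
            + coeff_C \<omega> v $ j * sin (a * t) + coeff_D \<omega> v $ j * cos (a * t) + coeff_E \<omega> v $ j) \<and>
         (\<forall>i. z t $ i =
            a * alpha0 \<omega> v $ i * t
            + beta1 \<omega> v $ i * sinh (a * t) * sin (a * t) + beta2 \<omega> v $ i * cosh (a * t) * cos (a * t)
            + beta3 \<omega> v $ i * sinh (a * t) * cos (a * t) + beta4 \<omega> v $ i * cosh (a * t) * sin (a * t)
            + 1/2 * (alpha5 \<omega> v $ i * sinh (a * t) + alpha6 \<omega> v $ i * cosh (a * t)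
                     + alpha7 \<omega> v $ i * sin (a * t) + alpha8 \<omega> v $ i * cos (a * t))
            - beta2 \<omega> v $ i) \<and>
         - (x t $ 1)\<^sup>2 + (x t $ 2)\<^sup>2 + (x t $ 3)\<^sup>2 + (x t $ 4)\<^sup>2
           = - 16 * c1 * c2 * (sinh (a * t / 2))\<^sup>2 + 16 * k * (sin (a * t / 2))\<^sup>2 \<and>
         (z t $ 1)\<^sup>2 + (z t $ 2)\<^sup>2 + (z t $ 3)\<^sup>2
           = 4 * (a * t * (- c1 * c2 + k) + c1 * c2 * sinh (a * t) - k * sin (a * t))\<^sup>2
             - 4 * k * (c1\<^sup>2 * exp (a * t) + c2\<^sup>2 * exp (- (a * t)))
                 * (2 * sin (a * t) * sinh (a * t) + 2 * cos (a * t) - 2 * cosh (a * t))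
             + 8 * c1 * c2 * k
                 * (2 * sin (a * t) * sinh (a * t) + 2 * cos (a * t) - 2 * cosh (a * t))) \<and>
      - c1 * c2 + k = 1 / (4 * a\<^sup>2) * lorentz_sq v)"
proof -
  note T = assms(1,2) and sol = assms(3) and nondeg = assms(7)
  note ode = hamiltonian_solution_ode[OF T sol \<open>x 0 = 0\<close> assms(6)]
  note eq = geodesic_formulas(1,2)[OF nondeg T _ \<open>x 0 = 0\<close> \<open>z 0 = 0\<close> ode]
  note formulas = geodesic_formulas(3-)[OF nondeg]
  show ?thesis
    unfolding Let_def
    by (intro conjI ballI allI; (simp only: eq)?)
      (rule hamiltonian_solution_momentum_const[OF T sol] formulas; assumption)+
qed

end
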